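(* The following hold. (a) Barnes' $G$-function belongs to $\mathcal G$ and increases on the interval $(\beta_G,\infty)$. Its inverse maps $(G(\beta_G),\infty)$ to $(\beta_G,\infty)$ and it can be extended to a univalent Pick-function. (b) The reciprocal $1/\Gamma_2$ of Barnes' double gamma function belongs to $\mathcal G$ and increases on the interval $(\beta_2,\infty)$. Its inverse maps $(1/\Gamma_2(\beta_2),\infty)$ to $(\beta_2,\infty)$ and it can be extended to a univalent Pick-function. Here $\beta_G>0$ and $\beta_2>0$ denote the local minimum points on the positive half line of $G$ and of $1/\Gamma_2$, respectively.
   Context: A Pick-function is a holomorphic function $p$ in the open upper half plane $\mathbb C_+$ with $\Im p(z)\ge0$ for all $z\in\mathbb C_+$. The class $\mathcal G$ consists of the entire functions $$f(z)=z^re^{az^2+bz}\prod_{k=1}^\infty\left(1+\frac z{\lambda_k}\right)e^{-z/\lambda_k+z^2/(2\lambda_k^2)},$$ where $r$ is a non-negative integer, $a,b\in\mathbb R$, $0<\lambda_1\le\lambda_2\le\cdots$, $\sum_k\lambda_k^{-2}=\infty$ and $\sum_k\lambda_k^{-3}<\infty$, which decrease on some open interval of the positive real line. If $f\in\mathcal G$ and $r>0$, there is a bounded interval $(\alpha,\beta)$ with $0<\alpha<\beta$ such that $f$ decreases on $(\alpha,\beta)$ and increases on $(0,\alpha)$ and on $(\beta,\infty)$; $\beta$ is the local minimum point of $f$ on $(0,\infty)$. Barnes' $G$-function is the entire function given by $$G(z+1)=(2\pi)^{z/2}e^{-((1+\gamma)z^2+z)/2}\prod_{k=1}^\infty\left(1+\frac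 zk\right)^ke^{-z+z^2/(2k)},$$ where $\gamma$ is Euler's constant; it satisfies $G(z+1)=\Gamma(z)G(z)$. The double gamma function is $\Gamma_2(z)=(2\pi)^{z/2}/G(z)$. *)

theory Defs
  imports "HOL-Complex_Analysis.Complex_Analysis"
begin

abbreviation upper_half_plane :: "complex set" where
  "upper_half_plane \<equiv> {z. Im z > 0}"

definition Pick_function :: "(complex \<Rightarrow> complex) \<Rightarrow> bool" where
  "Pick_function p \<longleftrightarrow>
     p holomorphic_on upper_half_plane \<and> (\<forall>z\<in>upper_half_plane. Im (p z) \<ge> 0)"

text \<open>
  A real function \<open>\<phi>\<close> on a set \<open>I\<close> of reals extends to a univalent Pick-function \<open>p\<close> if
  \<open>p\<close> continues analytically across \<open>I\<close> and agrees there with \<open>\<phi>\<close>. Without a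
  condition linking the values of \<open>p\<close> on \<open>I\<close> to those in the upper half plane,
  agreement on \<open>I\<close> would be meaningless.
\<close>
definition extends_to_univalent_Pick_function :: "(real \<Rightarrow> real) \<Rightarrow> real set \<Rightarrow> bool" where
  "extends_to_univalent_Pick_function \<phi> I \<longleftrightarrow>
     (\<exists>p. Pick_function p \<and> inj_on p upper_half_plane \<and>
          p analytic_on (upper_half_plane \<union> complex_of_real ` I) \<and>
          (\<forall>x\<in>I. p (complex_of_real x) = complex_of_real (\<phi> x)))"

text \<open>
  The functions considered below are real on the real axis, so that taking the real part
  only changes the type.
\<close>
definition on_reals :: "(complex \<Rightarrow> complex) \<Rightarrow> real \<Rightarrow> real" where
  "on_reals f x = Re (f (complex_of_real x))"

text \<open>The sequence \<open>\<lambda>\<^sub>1 \<le> \<lambda>\<^sub>2 \<le> \<dots>\<close> is \<open>l 0 \<le> l 1 \<le> \<dots>\<close>.\<close>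
definition class_G :: "(complex \<Rightarrow> complex) set" where
  "class_G = {f. f holomorphic_on UNIV \<and>
     (\<exists>(r::nat) (a::real) (b::real) (l::nat \<Rightarrow> real).
        (\<forall>k. 0 < l k) \<and> incseq l \<and>
        \<not> summable (\<lambda>k. 1 / l k ^ 2) \<and> summable (\<lambda>k. 1 / l k ^ 3) \<and>
        (\<forall>z. f z = z ^ r * exp (of_real a * z ^ 2 + of_real b * z) *
           (\<Prod>k. (1 + z / of_real (l k)) *
                 exp (- z / of_real (l k) + z ^ 2 / (2 * of_real (l k) ^ 2))))) \<and>
     (\<exists>c d. 0 \<le> c \<and> c < d \<and> strict_antimono_on {c<..<d} (on_reals f))}"

definition is_pos_local_min :: "(real \<Rightarrow> real) \<Rightarrow> real \<Rightarrow> bool" where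
  "is_pos_local_min g x \<longleftrightarrow> 0 < x \<and> (\<forall>\<^sub>F y in nhds x. g x \<le> g y)"

definition pos_local_min_point :: "(real \<Rightarrow> real) \<Rightarrow> real" where
  "pos_local_min_point g = (THE x. is_pos_local_min g x)"

text \<open>
  The classical formula is for \<open>G(z+1)\<close>, with the product over \<open>k \<ge> 1\<close>; it is shifted
  here in both respects.
\<close>
definition barnes_G :: "complex \<Rightarrow> complex" where
  "barnes_G s = (let z = s - 1 in
     of_real (2 * pi) powr (z / 2) *
     exp (- ((1 + of_real euler_mascheroni) * z ^ 2 + z) / 2) *
     (\<Prod>k. (1 + z / of_nat (Suc k)) ^ Suc k *
           exp (- z + z ^ 2 / (2 * of_nat (Suc k)))))"

text \<open>
  At the zeros of \<open>G\<close>, which are the poles of \<open>\<Gamma>\<^sub>2\<close>, the convention \<open>x / 0 = 0\<close> gives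
  \<open>Gamma2 z = 0\<close>, and then \<open>1 / Gamma2 z = 0\<close>. Hence \<open>\<lambda>z. 1 / Gamma2 z\<close> is the entire
  function \<open>1/\<Gamma>\<^sub>2\<close> at every point.
\<close>
definition Gamma2 :: "complex \<Rightarrow> complex" where
  "Gamma2 z = of_real (2 * pi) powr (z / 2) / barnes_G z"

definition beta_G :: real where
  "beta_G = pos_local_min_point (on_reals barnes_G)"

definition beta_2 :: real where
  "beta_2 = pos_local_min_point (on_reals (\<lambda>z. 1 / Gamma2 z))"

end

theory Submission
  imports Defs
begin

text \<open>
  Let \<open>E\<^sub>n\<close> be the partial products of \<open>f \<in> \<G>\<close>, with the exponential factors collected into
  \<open>exp (A\<^sub>n z\<^sup>2 + B\<^sub>n z)\<close>. As \<open>\<Sum> 1 / \<lambda>\<^sub>k\<^sup>2 = \<infinity>\<close>, eventually \<open>A\<^sub>n > 0\<close>. If the logarithmic derivative of \<open>E\<^sub>n\<close>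
  is negative at some point of the positive half line, which holds for large \<open>n\<close> because \<open>f\<close> decreases
  somewhere, then it has no zeros in the upper half plane. Hence a branch of \<open>log E\<^sub>n\<close> maps the part of the upper
  half plane where its imaginary part lies in \<open>(0, \<pi>)\<close> properly and locally biholomorphically onto
  this strip, so it is a covering of a simply connected domain and has sections. Thus each branch
  of the inverse of \<open>E\<^sub>n\<close> that takes a value in the upper half plane is a univalent Pick-function;
  by Montel's theorem this is inherited by \<open>f\<close>. Identity of analytic functions glues such a branch
  to the inverse of \<open>f\<close> on \<open>(\<beta>, \<infinity>)\<close>.

  The location of \<open>\<beta>\<close> follows from the convexity of the logarithmic derivative on the positive half
  line. Barnes' product for \<open>G (z + 1)\<close> is transformed into the product of a member of \<open>\<G>\<close> by telescoping
  the partial products, with Stirling's formula giving the constant.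
\<close>

section \<open>Branches of the inverse in the upper half plane\<close>

text \<open>Local inverses are cheap; the obstacle is to have one on the whole half plane, which
  needs properness and the absence of critical points. For \<open>E\<^sub>n\<close> both are
  elementary: \<open>A\<^sub>n z\<^sup>2\<close> outweighs the finitely many logarithms at infinity,
  and critical points are zeros of an explicit sum of simple fractions. No growth estimate for the
  infinite product is needed; the divergence of the sum of inverse squares enters only through
  \<open>A\<^sub>n > 0\<close>. All other information about \<open>f\<close> is drawn from its
  values at three positive points. For \<open>G\<close> these are 1, 2, 4, for the reciprocal of the
  double gamma function 1, 2, 6, and the values come from the functional equation of
  \<open>G\<close>. As \<open>G 1 = G 2\<close>, the values alone show no decrease; it results from
  strict convexity of the logarithmic derivative, to which the simple zero at 0 contributes the
  strict part.\<close>

lemma proper_local_biholomorphism_covering: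
  assumes U: "open U" "U \<noteq> {}" and f: "f holomorphic_on U" "f \<in> U \<rightarrow> S"
    and S: "open S" "connected S"
    and nz: "\<And>z. z \<in> U \<Longrightarrow> deriv f z \<noteq> 0"
    and proper: "\<And>K. compact K \<Longrightarrow> K \<subseteq> S \<Longrightarrow> compact (U \<inter> f -` K)"
  shows "covering_space U f S"
proof -
  have contf: "continuous_on U f"
    by (simp add: f holomorphic_on_imp_continuous_on)
  have inj: "\<exists>r>0. ball z r \<subseteq> U \<and> inj_on f (ball z r)" if "z \<in> U" for z
    using has_complex_derivative_locally_injective[OF f(1) that U(1) nz[OF that]] by blast
  have open_im: "open (f ` V)" if V: "V \<subseteq> U" "open V" for V
  proof (subst open_contains_ball, intro ballI)
    fix w assume "w \<in> f ` V"
    then obtain z where z: "z \<in> V" "w = f z" by blast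
    obtain r where r: "r > 0" "ball z r \<subseteq> U" "inj_on f (ball z r)" using inj z V by blast
    obtain e where e: "e > 0" "ball z e \<subseteq> V" using V z openE by blast
    define d where "d = min r e"
    have "open (f ` ball z d)"
      by (rule open_mapping_thm3) (use r e d_def in \<open>auto intro: inj_on_subset intro!: holomorphic_on_subset[OF f(1)]\<close>)
    moreover have "w \<in> f ` ball z d" using z r e by (auto simp: d_def)
    ultimately obtain \<epsilon> where "\<epsilon> > 0" "ball w \<epsilon> \<subseteq> f ` ball z d" by (meson openE)
    moreover have "f ` ball z d \<subseteq> f ` V" using e by (auto simp: d_def)
    ultimately show "\<exists>\<epsilon>>0. ball w \<epsilon> \<subseteq> f ` V" by blast
  qed
  have surj: "f ` U = S"
  proof -
    \<comment> \<open>The image is relatively closed: near \<open>w\<close> it coincides with the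
      image of the compact preimage of a closed ball.\<close>
    have "open (S - f ` U)"
    proof (subst open_contains_ball, intro ballI)
      fix w assume w: "w \<in> S - f ` U"
      obtain e where e: "e > 0" "cball w e \<subseteq> S" using S(1) w open_contains_cball by blast
      have "compact (f ` (U \<inter> f -` cball w e))"
        by (intro compact_continuous_image continuous_on_subset[OF contf] proper e) auto
      then have "open (ball w e - f ` (U \<inter> f -` cball w e))"
        by (simp add: compact_imp_closed open_Diff)
      moreover have "w \<in> ball w e - f ` (U \<inter> f -` cball w e)" using w e by auto
      ultimately obtain d where "d > 0" "ball w d \<subseteq> ball w e - f ` (U \<inter> f -` cball w e)"
        by (meson openE)
      moreover have "ball w e - f ` (U \<inter> f -` cball w e) \<subseteq> S - f ` U" using e by force
      ultimately show "\<exists>d>0. ball w d \<subseteq> S - f ` U" by blast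
    qed
    moreover have "open (f ` U)" using open_im U by blast
    moreover have "f ` U \<subseteq> S" using f by blast
    ultimately show ?thesis
      using connectedD[OF S(2), of "f ` U" "S - f ` U"] U(2) by blast
  qed
  show ?thesis
  proof (rule covering_spaceI[OF contf surj])
    fix w assume w: "w \<in> S"
    define F where "F = U \<inter> f -` {w}"
    have "compact F" unfolding F_def using proper w by auto
    obtain r where r: "\<And>z. z \<in> F \<Longrightarrow> r z > 0" "\<And>z. z \<in> F \<Longrightarrow> ball z (r z) \<subseteq> U"
        "\<And>z. z \<in> F \<Longrightarrow> inj_on f (ball z (r z))"
      using inj unfolding F_def by (metis IntD1)
    have "finite F"
    proof -
      obtain D where D: "D \<subseteq> F" "finite D" "F \<subseteq> (\<Union>z\<in>D. ball z (r z))"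
        using compactE_image[OF \<open>compact F\<close>, of F "\<lambda>z. ball z (r z)"] r(1) by force
      \<comment> \<open>A fibre point in the ball about \<open>d\<close> is \<open>d\<close> itself,
        as \<open>f\<close> is injective there and takes the value \<open>w\<close> at both. So the
        finite subcover exhausts the fibre.\<close>
      have "z \<in> D" if "z \<in> F" for z
      proof -
        obtain d where d: "d \<in> D" "z \<in> ball d (r d)" using D(3) \<open>z \<in> F\<close> by blast
        have "d \<in> F" using d D by blast
        then have "d \<in> ball d (r d)" "f z = f d" using r that by (auto simp: F_def)
        then show ?thesis using inj_onD[OF r(3)[OF \<open>d \<in> F\<close>]] d by metis
      qed
      then show ?thesis using rev_finite_subset[OF D(2), of F] by blast
    qed
    obtain \<epsilon> where \<epsilon>: "\<epsilon> > 0" "\<And>z. z \<in> F \<Longrightarrow> \<epsilon> \<le> r z"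
        "\<And>z z'. z \<in> F \<Longrightarrow> z' \<in> F \<Longrightarrow> z \<noteq> z' \<Longrightarrow> 2 * \<epsilon> \<le> dist z z'"
    proof -
      \<comment> \<open>The entry 1 keeps \<open>X\<close> nonempty whatever the fibre is; half
        distances make the balls about distinct fibre points disjoint.\<close>
      define X where "X = insert 1 (r ` F \<union> (\<lambda>(z,z'). dist z z' / 2) ` {(z,z') \<in> F \<times> F. z \<noteq> z'})"
      have fin: "finite {(z,z') \<in> F \<times> F. z \<noteq> z'}"
        by (rule finite_subset[of _ "F \<times> F"]) (use \<open>finite F\<close> in auto)
      then have X: "finite X" "X \<noteq> {}" using \<open>finite F\<close> by (auto simp: X_def)
      have "Min X > 0" using X r(1) by (subst Min_gr_iff) (auto simp: X_def)
      moreover have "Min X \<le> r z" if "z \<in> F" for z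
        using X that by (intro Min_le) (auto simp: X_def)
      moreover have "2 * Min X \<le> dist z z'" if "z \<in> F" "z' \<in> F" "z \<noteq> z'" for z z'
      proof -
        have "Min X \<le> dist z z' / 2" using X that by (intro Min_le) (auto simp: X_def intro!: image_eqI[of _ _ "(z,z')"])
        then show ?thesis by simp
      qed
      ultimately show ?thesis using that by blast
    qed
    have sub: "ball z \<epsilon> \<subseteq> U" "inj_on f (ball z \<epsilon>)" if "z \<in> F" for z
      using r[OF that] \<epsilon>(2)[OF that] by (auto intro: inj_on_subset)
    define W where "W = S \<inter> (\<Inter>z\<in>F. f ` ball z \<epsilon>)"
    have "open W" unfolding W_def using \<open>finite F\<close> open_im sub S by blast
    moreover have "w \<in> W" using w \<epsilon>(1) by (auto simp: W_def F_def)
    ultimately obtain e where e: "e > 0" "cball w e \<subseteq> W" using open_contains_cball by blast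
    \<comment> \<open>Points far from the fibre might be mapped close to \<open>w\<close>. They are
      confined to the compact set \<open>C\<close>, whose image misses \<open>w\<close>; a
      neighbourhood of \<open>w\<close> that avoids this image is evenly covered by the
      balls.\<close>
    define C where "C = (U \<inter> f -` cball w e) - (\<Union>z\<in>F. ball z \<epsilon>)"
    have "compact C" unfolding C_def
      by (intro compact_diff proper) (use e in \<open>auto simp: W_def\<close>)
    then have "compact (f ` C)"
      by (intro compact_continuous_image continuous_on_subset[OF contf]) (auto simp: C_def)
    moreover have "w \<notin> f ` C" using \<epsilon>(1) by (auto simp: C_def F_def)
    ultimately have "open (ball w e - f ` C)" "w \<in> ball w e - f ` C"
      using e by (auto simp: compact_imp_closed open_Diff)
    then obtain T where T: "open T" "w \<in> T" "T \<subseteq> ball w e" "T \<inter> f ` C = {}" by blast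
    define v where "v = (\<lambda>z. ball z \<epsilon> \<inter> f -` T) ` F"
    have "T \<subseteq> W" using T e by force
    have opn: "open (ball z \<epsilon> \<inter> f -` T)" if "z \<in> F" for z
      using continuous_open_preimage[OF continuous_on_subset[OF contf sub(1)[OF that]] _ T(1)] by simp
    have TeqU: "\<exists>q. homeomorphism u T f q" if u: "u \<in> v" for u
    proof -
      obtain z where z: "z \<in> F" "u = ball z \<epsilon> \<inter> f -` T" using u v_def by blast
      have "u \<subseteq> U" "open u" using z sub opn by auto
      have "T \<subseteq> f ` ball z \<epsilon>" using z(1) \<open>T \<subseteq> W\<close> unfolding W_def by blast
      then have fu: "f ` u = T" using z(2) by blast
      have iu: "inj_on f u" using sub(2)[OF z(1)] z(2) by (meson inf_le1 inj_on_subset)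
      obtain g where g: "g holomorphic_on (f ` u)" "\<And>x. x \<in> u \<Longrightarrow> g (f x) = x"
        using holomorphic_has_inverse[OF holomorphic_on_subset[OF f(1) \<open>u \<subseteq> U\<close>] \<open>open u\<close> iu] by metis
      have "homeomorphism u T f g"
        unfolding homeomorphism_def
      proof (intro conjI ballI)
        show "continuous_on u f" using contf \<open>u \<subseteq> U\<close> continuous_on_subset by blast
        show "continuous_on T g" using holomorphic_on_imp_continuous_on[OF g(1)] fu by simp
        show "g ` T = u" using g(2) by (simp add: fu[symmetric] image_image)
        show "f (g y) = y" if "y \<in> T" for y
          using that g(2) unfolding fu[symmetric] by auto
      qed (use g fu in auto)
      then show ?thesis by blast
    qed
    show "\<exists>T. w \<in> T \<and> openin (top_of_set S) T \<and>
             (\<exists>v. \<Union>v = U \<inter> f -` T \<and> (\<forall>u\<in>v. openin (top_of_set U) u) \<and> pairwise disjnt v \<and>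
                 (\<forall>u\<in>v. \<exists>q. homeomorphism u T f q))"
    proof (intro exI[of _ T] exI[of _ v] conjI)
      show "openin (top_of_set S) T" using T \<open>T \<subseteq> W\<close> S by (auto simp: openin_open_eq W_def)
      show "\<Union>v = U \<inter> f -` T"
        using T sub by (force simp: v_def C_def)
      show "\<forall>u\<in>v. openin (top_of_set U) u"
        using opn sub U by (auto simp: v_def openin_open_eq)
      show "pairwise disjnt v"
      proof (rule pairwiseI)
        fix u u' assume u: "u \<in> v" "u' \<in> v" "u \<noteq> u'"
        then obtain a b where ab: "a \<in> F" "b \<in> F" "a \<noteq> b"
            "u \<subseteq> ball a \<epsilon>" "u' \<subseteq> ball b \<epsilon>"
          unfolding v_def by blast
        have "2 * \<epsilon> \<le> dist a b" using \<epsilon>(3) ab by blast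
        then have "disjnt (ball a \<epsilon>) (ball b \<epsilon>)"
          unfolding disjnt_iff using dist_triangle2[of a b] by (auto, smt (verit))
        then show "disjnt u u'" using ab(4,5) by (meson disjnt_subset1 disjnt_subset2)
      qed
    qed (use T TeqU in auto)
  qed
qed

text \<open>As \<open>S\<close> is simply connected, its identity map lifts through the covering,
  with the value \<open>a\<close> prescribed over \<open>f a\<close>.\<close>

lemma proper_local_biholomorphism_section:
  assumes U: "open U" and f: "f holomorphic_on U" "f \<in> U \<rightarrow> S"
    and S: "open S" "simply_connected S"
    and nz: "\<And>z. z \<in> U \<Longrightarrow> deriv f z \<noteq> 0"
    and proper: "\<And>K. compact K \<Longrightarrow> K \<subseteq> S \<Longrightarrow> compact (U \<inter> f -` K)"
    and a: "a \<in> U"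
  obtains g where "g holomorphic_on S" "g \<in> S \<rightarrow> U" "g (f a) = a" "\<And>w. w \<in> S \<Longrightarrow> f (g w) = w"
proof -
  have cov: "covering_space U f S"
    using proper_local_biholomorphism_covering[OF U _ f S(1) simply_connected_imp_connected[OF S(2)] nz proper] a by blast
  have "f a \<in> S" using a f by blast
  then obtain g where g: "continuous_on S g" "g \<in> S \<rightarrow> U" "g (f a) = a" "\<And>w. w \<in> S \<Longrightarrow> f (g w) = w"
    using covering_space_lift_strong[OF cov a _ S(2) open_imp_locally_path_connected[OF S(1)],
        of "f a" "\<lambda>w. w"] by (auto intro: continuous_on_id)
  moreover have "g holomorphic_on S"
    by (rule covering_space_lift_is_holomorphic[OF cov U f(1) holomorphic_on_id _ _ g(1)])
       (use g in auto)
  ultimately show ?thesis using that by blast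
qed

text \<open>
  Unlike being a covering, this property passes to locally uniform limits.
\<close>
definition has_sections :: "(complex \<Rightarrow> complex) \<Rightarrow> bool" where
  "has_sections f \<longleftrightarrow>
     (\<forall>z0. Im z0 > 0 \<and> Im (f z0) > 0 \<longrightarrow>
        (\<exists>p. p holomorphic_on upper_half_plane \<and> p \<in> upper_half_plane \<rightarrow> upper_half_plane \<and>
             (\<forall>w\<in>upper_half_plane. f (p w) = w) \<and> p (f z0) = z0))"

section \<open>Critical points and properness of the logarithm of a partial product\<close>

lemma open_upper_half_plane: "open upper_half_plane"
  by (rule open_halfspace_Im_gt)

lemma convex_upper_half_plane: "convex upper_half_plane"
  by (rule convex_halfspace_Im_gt)

text \<open>The left side equals \<open>|w - t|^2 / (t * |w|^2)\<close>. Its weight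
  \<open>(Re w - t) / Im w\<close> is unchanged when the same real number is added to
  \<open>t\<close> and \<open>w\<close>, so that one weight will serve all the fractions
  \<open>1 / (x0 + l k)\<close> at once.\<close>

lemma inverse_support_inequality:
  fixes t :: real and w :: complex
  assumes "t > 0" "Im w > 0"
  shows "1 / t - Re (1 / w) + (Re w - t) / Im w * Im (1 / w) \<ge> 0"
proof -
  define N where "N = (Re w)\<^sup>2 + (Im w)\<^sup>2"
  have N: "N > 0" using assms by (auto simp: N_def intro: add_nonneg_pos)
  have "1 / t - Re (1 / w) + (Re w - t) / Im w * Im (1 / w) = 1 / t - (2 * Re w - t) / N"
  proof -
    have "Re (1 / w) = Re w / N" "Im (1 / w) = - Im w / N"
      by (simp_all add: Re_divide Im_divide N_def)
    then have "1 / t - Re (1 / w) + (Re w - t) / Im w * Im (1 / w) = 1 / t - Re w / N - (Re w - t) / N"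
    proof -
      have "(Re w - t) / Im w * Im (1 / w) = - ((Re w - t) / N)"
        using assms \<open>Im (1 / w) = - Im w / N\<close> by simp
      then show ?thesis using \<open>Re (1 / w) = Re w / N\<close> by simp
    qed
    then show ?thesis by (simp add: diff_divide_distrib)
  qed
  also have "\<dots> = ((Re w - t)\<^sup>2 + (Im w)\<^sup>2) / (t * N)"
    using assms N by (simp add: field_simps N_def power2_eq_square)
  also have "\<dots> \<ge> 0" using assms N by simp
  finally show ?thesis .
qed

text \<open>
  If the logarithmic derivative \<open>\<psi>\<close> vanished at \<open>z\<close>, then
  \<open>\<psi> x0 = \<psi> x0 - Re (\<psi> z) + c * Im (\<psi> z)\<close> for every \<open>c\<close>. With
  \<open>c = (Re z - x0) / Im z\<close> the quadratic part of \<open>log f\<close> cancels and each remaining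
  term is nonnegative by the preceding inequality.
\<close>
lemma log_deriv_nonzero_upper_half_plane:
  fixes A B x0 :: real and l :: "nat \<Rightarrow> real" and r n :: nat and z :: complex
  assumes l: "\<And>k. k < n \<Longrightarrow> l k > 0" and x0: "x0 > 0" and z: "Im z > 0"
    and neg: "r / x0 + 2 * A * x0 + B + (\<Sum>k<n. 1 / (x0 + l k)) < 0"
  shows "r / z + 2 * A * z + B + (\<Sum>k<n. 1 / (z + l k)) \<noteq> 0" (is "?\<phi> \<noteq> 0")
proof
  assume 0: "?\<phi> = 0"
  define T where "T = (\<lambda>(u::real) v. u - Re v + (Re z - x0) / Im z * Im v)"
  have T_inv: "T (1 / (x0 + m)) (1 / (z + m)) \<ge> 0" if "m \<ge> 0" for m :: real
    using inverse_support_inequality[of "x0 + m" "z + m"] x0 z that by (simp add: T_def)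
  have "T (1 / x0) (1 / z) \<ge> 0" using T_inv[of 0] by simp
  then have "real r * T (1 / x0) (1 / z) \<ge> 0" by simp
  moreover have "(\<Sum>k<n. T (1 / (x0 + l k)) (1 / (z + l k))) \<ge> 0"
    using l by (intro sum_nonneg T_inv) (auto intro: less_imp_le)
  ultimately have "0 \<le> real r * T (1 / x0) (1 / z) + (\<Sum>k<n. T (1 / (x0 + l k)) (1 / (z + l k)))"
    by simp
  also have "real r * T (1 / x0) (1 / z) = T (r / x0) (r / z)"
    using z by (auto simp: T_def Re_divide Im_divide algebra_simps)
  also have "(\<Sum>k<n. T (1 / (x0 + l k)) (1 / (z + l k))) =
               T (\<Sum>k<n. 1 / (x0 + l k)) (\<Sum>k<n. 1 / (z + l k))"
    by (simp add: T_def sum.distrib sum_subtractf sum_distrib_left sum_divide_distrib)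
  also have "T (r / x0) (r / z) + \<dots> =
      T (r / x0 + 2 * A * x0 + B + (\<Sum>k<n. 1 / (x0 + l k))) ?\<phi>"
    using z by (simp add: T_def field_simps)
  also have "\<dots> < 0" using neg by (simp only: 0) (simp add: T_def)
  finally show False by simp
qed

text \<open>The imaginary part of the principal logarithm is bounded by \<pi> and its real part
  grows more slowly than its argument, so the quotient is at most of order \<open>1 / |z|\<close>,
  even across the branch cut.\<close>

lemma tendsto_Ln_affine_over_square:
  fixes a c :: real
  assumes "c > 0"
  shows "((\<lambda>z::complex. Ln (a + z * c) / z\<^sup>2) \<longlongrightarrow> 0) at_infinity"
proof (rule Lim_null_comparison)
  have "eventually (\<lambda>z::complex. norm z \<ge> (1 + \<bar>a\<bar>) / c + 1) at_infinity"
    by (auto simp: eventually_at_infinity)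
  then show "eventually (\<lambda>z::complex. norm (Ln (a + z * c) / z\<^sup>2) \<le>
      (\<bar>a\<bar> + pi) * norm (inverse z) ^ 2 + c * norm (inverse z)) at_infinity"
  proof eventually_elim
    case (elim z)
    have pos: "norm z > 0" using elim assms by (smt (verit) divide_nonneg_pos)
    have "1 + \<bar>a\<bar> \<le> norm z * c" using elim assms by (simp add: field_simps)
    also have "\<dots> = norm (z * c)" using assms by (simp add: norm_mult)
    also have "\<dots> \<le> norm (a + z * c) + \<bar>a\<bar>"
      using norm_triangle_ineq4[of "a + z * c" a] by simp
    finally have ge: "norm (a + z * c) \<ge> 1" by simp
    then have nz: "a + z * c \<noteq> 0" by auto
    have "norm (Ln (a + z * c)) \<le> \<bar>Re (Ln (a + z * c))\<bar> + \<bar>Im (Ln (a + z * c))\<bar>"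
      by (rule cmod_le)
    also have "\<bar>Re (Ln (a + z * c))\<bar> = ln (norm (a + z * c))" using ge nz by simp
    also have "\<dots> \<le> norm (a + z * c)" using ge ln_le_minus_one[of "norm (a + z * c)"] by linarith
    also have "\<dots> \<le> \<bar>a\<bar> + norm z * c"
      using norm_triangle_ineq[of a "z * c"] assms by (simp add: norm_mult)
    also have "\<bar>Im (Ln (a + z * c))\<bar> \<le> pi"
      using Im_Ln_le_pi[OF nz] mpi_less_Im_Ln[OF nz] by simp
    finally have "norm (Ln (a + z * c)) \<le> \<bar>a\<bar> + norm z * c + pi" by simp
    then have "norm (Ln (a + z * c) / z\<^sup>2) \<le> (\<bar>a\<bar> + norm z * c + pi) / (norm z)\<^sup>2"
      by (simp add: norm_divide norm_power divide_right_mono)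
    also have "\<dots> = (\<bar>a\<bar> + pi) * norm (inverse z) ^ 2 + c * norm (inverse z)"
      unfolding norm_inverse using pos by (simp add: field_simps power2_eq_square)
    finally show ?case .
  qed
  have n0: "((\<lambda>z::complex. norm (inverse z)) \<longlongrightarrow> 0) at_infinity"
    using tendsto_norm[OF tendsto_inverse_0] by simp
  show "((\<lambda>z::complex. (\<bar>a\<bar> + pi) * norm (inverse z) ^ 2 + c * norm (inverse z)) \<longlongrightarrow> 0) at_infinity"
    using tendsto_add[OF tendsto_mult_left[OF tendsto_power[OF n0, of 2]] tendsto_mult_left[OF n0]] by simp
qed

lemma exp_poly_has_sections:
  fixes A B x0 :: real and l :: "nat \<Rightarrow> real" and r n :: nat
  assumes A: "A > 0" and l: "\<And>k. k < n \<Longrightarrow> l k > 0" and x0: "x0 > 0"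
    and neg: "r / x0 + 2 * A * x0 + B + (\<Sum>k<n. 1 / (x0 + l k)) < 0"
  shows "has_sections (\<lambda>z::complex. z ^ r * exp (A * z\<^sup>2 + B * z) * (\<Prod>k<n. 1 + z / l k))"
    (is "has_sections ?E")
  unfolding has_sections_def
proof (intro allI impI, elim conjE)
  fix z0 assume z0: "Im z0 > 0" "Im (?E z0) > 0"
  define L0 where "L0 = (\<lambda>z::complex. r * Ln z + (A * z\<^sup>2 + B * z) + (\<Sum>k<n. Ln (1 + z / l k)))"
  \<comment> \<open>The sum of principal logarithms can differ from the principal logarithm of the
    product by a multiple of \<open>2 * pi * \<i>\<close>. The shift by \<kappa> puts
    \<open>L z0\<close> into the strip.\<close>
  define \<kappa> where "\<kappa> = Ln (?E z0) - L0 z0"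
  define L where "L = (\<lambda>z. L0 z + \<kappa>)"
  have contE: "continuous_on UNIV ?E"
    using l by (intro continuous_intros) fastforce
  have factor: "Im (1 + z / l k) > 0" if "Im z > 0" "k < n" for z :: complex and k
    using that l[OF that(2)] by simp
  have factor_nz: "1 + z / l k \<noteq> 0" if "Im z > 0" "k < n" for z :: complex and k
    using factor[OF that] by (metis less_irrefl zero_complex.sel(2))
  have exp_L0: "exp (L0 z) = ?E z" if "Im z > 0" for z
  proof -
    have "z \<noteq> 0" using that by auto
    then show ?thesis
      using factor_nz that by (simp add: L0_def exp_add exp_sum exp_of_nat_mult)
  qed
  have "?E z0 \<noteq> 0" using z0(2) by (metis less_irrefl zero_complex.sel(2))
  then have "exp \<kappa> = 1" by (simp add: \<kappa>_def exp_diff exp_L0 z0)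
  then have exp_L: "exp (L z) = ?E z" if "Im z > 0" for z
    by (simp only: L_def exp_add exp_L0[OF that]) simp
  have L_z0: "L z0 = Ln (?E z0)" by (simp add: L_def \<kappa>_def)
  have DL: "(L has_field_derivative (r / z + 2 * A * z + B + (\<Sum>k<n. 1 / (z + l k)))) (at z)"
    if z: "Im z > 0" for z :: complex
  proof -
    have *: "((\<lambda>z::complex. Ln (1 + z / l k)) has_field_derivative 1 / (z + l k)) (at z)" if "k < n" for k
    proof -
      have "1 + z / l k \<notin> \<real>\<^sub>\<le>\<^sub>0" using factor[OF z that] complex_nonpos_Reals_iff by force
      moreover have "z + l k \<noteq> 0" using z by (auto simp: complex_eq_iff)
      moreover have "l k \<noteq> 0" using l that by force
      ultimately show ?thesis
        by (auto intro!: derivative_eq_intros simp: field_simps)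
    qed
    have "z \<notin> \<real>\<^sub>\<le>\<^sub>0" using z complex_nonpos_Reals_iff by force
    then have d0: "(Ln has_field_derivative 1 / z) (at z)" using has_field_derivative_Ln by (auto simp: inverse_eq_divide)
    have d1: "((\<lambda>z. of_real A * z\<^sup>2 + of_real B * z) has_field_derivative 2 * A * z + B) (at z)"
      by (auto intro!: derivative_eq_intros)
    have d2: "((\<lambda>z. \<Sum>k<n. Ln (1 + z / l k)) has_field_derivative (\<Sum>k<n. 1 / (z + l k))) (at z)"
      by (intro DERIV_sum *) auto
    show ?thesis
      using DERIV_add[OF DERIV_add[OF DERIV_add[OF DERIV_cmult[OF d0] d1] d2] DERIV_const[of \<kappa>], of r]
      unfolding L_def L0_def by (simp add: add.assoc)
  qed
  txt \<open>\<open>L\<close> is proper over the strip \<open>S\<close>: it grows quadratically at infinity, and \<open>?E\<close> is real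
    on the real axis, so that preimages of a compact subset of \<open>S\<close> cannot accumulate there.\<close>
  define S where "S = {\<zeta>. 0 < Im \<zeta> \<and> Im \<zeta> < pi}"
  define U where "U = {z. Im z > 0 \<and> L z \<in> S}"
  have S_int: "S = {\<zeta>. Im \<zeta> > 0} \<inter> {\<zeta>. Im \<zeta> < pi}" by (auto simp: S_def)
  have "open S" "convex S"
    unfolding S_int by (auto intro!: convex_Int convex_halfspace_Im_gt convex_halfspace_Im_lt
                             open_Int open_halfspace_Im_gt open_halfspace_Im_lt)
  have contL: "continuous_on upper_half_plane L"
    by (meson DL DERIV_isCont continuous_at_imp_continuous_on mem_Collect_eq)
  have U_eq: "U = upper_half_plane \<inter> L -` S" by (auto simp: U_def)
  have "open U"
    unfolding U_eq by (rule continuous_open_preimage[OF contL open_upper_half_plane \<open>open S\<close>])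
  have holL: "L holomorphic_on U"
    using DL by (auto simp: U_def holomorphic_on_def field_differentiable_def intro: has_field_derivative_at_within)
  \<comment> \<open>\<open>Ln z\<close> is treated as the logarithm of the affine function with
    \<open>a = 0\<close> and \<open>c = 1\<close>.\<close>
  have "((\<lambda>z::complex. r * (Ln (of_real 0 + z * of_real 1) / z\<^sup>2) + (A + B * inverse z) +
          (\<Sum>k<n. Ln (of_real 1 + z * of_real (inverse (l k))) / z\<^sup>2) + \<kappa> * (inverse z)\<^sup>2)
          \<longlongrightarrow> of_nat r * 0 + (of_real A + of_real B * 0) + (\<Sum>k<n. 0) + \<kappa> * 0\<^sup>2) at_infinity"
    by (intro tendsto_add tendsto_mult tendsto_const tendsto_sum tendsto_power
          tendsto_Ln_affine_over_square tendsto_inverse_0) (use l in auto)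
  moreover have "eventually (\<lambda>z::complex. r * (Ln (of_real 0 + z * of_real 1) / z\<^sup>2) + (A + B * inverse z) +
          (\<Sum>k<n. Ln (of_real 1 + z * of_real (inverse (l k))) / z\<^sup>2) + \<kappa> * (inverse z)\<^sup>2 = L z / z\<^sup>2) at_infinity"
  proof -
    have "eventually (\<lambda>z::complex. norm z \<ge> 1) at_infinity" by (auto simp: eventually_at_infinity)
    then show ?thesis
    proof eventually_elim
      case (elim z)
      then have "z \<noteq> 0" by auto
      then have "(A * z\<^sup>2 + B * z) / z\<^sup>2 = A + B * inverse z" "\<kappa> / z\<^sup>2 = \<kappa> * (inverse z)\<^sup>2"
        by (simp_all add: field_simps power2_eq_square)
      moreover have "z * of_real (inverse (l k)) = z / l k" for k by (simp add: divide_inverse)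
      ultimately show ?case
        unfolding L_def L0_def add_divide_distrib[of _ \<kappa>] add_divide_distrib[of _ "sum _ _"]
          add_divide_distrib[of "of_nat r * _"] sum_divide_distrib by simp
    qed
  qed
  ultimately have lim: "((\<lambda>z. L z / z\<^sup>2) \<longlongrightarrow> A) at_infinity"
    by (simp add: tendsto_cong)
  have proper: "compact (U \<inter> L -` K)" if K: "compact K" "K \<subseteq> S" for K
  proof -
    obtain M where M: "M > 0" "\<And>\<zeta>. \<zeta> \<in> K \<Longrightarrow> norm \<zeta> \<le> M"
      using compact_imp_bounded[OF K(1)] bounded_pos by blast
    have "eventually (\<lambda>z. norm (L z / z\<^sup>2) > A / 2) at_infinity"
      using tendsto_norm[OF lim] A by (intro order_tendstoD) auto
    then obtain R where R: "\<And>z. norm z \<ge> R \<Longrightarrow> norm (L z / z\<^sup>2) > A / 2"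
      by (auto simp: eventually_at_infinity)
    \<comment> \<open>Beyond this radius \<open>norm (L z)\<close> exceeds
      \<open>A / 2 * norm z ^ 2\<close>, which is at least the bound \<open>M\<close> of
      \<open>K\<close>.\<close>
    have "norm z \<le> \<bar>R\<bar> + 1 + 2 * M / A" if "L z \<in> K" for z
    proof (rule ccontr)
      assume "\<not> norm z \<le> \<bar>R\<bar> + 1 + 2 * M / A"
      moreover have "2 * M / A > 0" using M A by simp
      ultimately have z: "norm z \<ge> R" "norm z \<ge> 1" "norm z \<ge> 2 * M / A" by linarith+
      have "2 * M / A * 1 \<le> norm z * norm z" using z M A by (intro mult_mono) auto
      then have "M \<le> A / 2 * (norm z)\<^sup>2" using A by (simp add: field_simps power2_eq_square)
      also have "\<dots> < norm (L z / z\<^sup>2) * (norm z)\<^sup>2"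
        using R[OF z(1)] z(2) by (intro mult_strict_right_mono) auto
      also have "\<dots> = norm (L z)"
      proof -
        have "z \<noteq> 0" using z(2) by auto
        then show ?thesis by (simp add: norm_divide norm_power)
      qed
      finally show False using M(2)[OF that] by simp
    qed
    then have "bounded (U \<inter> L -` K)" by (auto simp: bounded_iff)
    moreover have "closed (U \<inter> L -` K)"
      unfolding closed_sequential_limits
    proof (intro allI impI, elim conjE)
      fix x a assume x: "\<forall>n. x n \<in> U \<inter> L -` K" and lim_x: "x \<longlonglongrightarrow> a"
      have "\<And>n. L (x n) \<in> K" using x by blast
      then obtain \<zeta> s where \<zeta>: "\<zeta> \<in> K" "strict_mono s" "(\<lambda>n. L (x (s n))) \<longlonglongrightarrow> \<zeta>"
        using K(1)[unfolded compact_def, rule_format, of "\<lambda>n. L (x n)"] by (auto simp: o_def)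
      have xs: "(\<lambda>n. x (s n)) \<longlonglongrightarrow> a"
        using LIMSEQ_subseq_LIMSEQ[OF lim_x \<zeta>(2)] by (simp add: o_def)
      have "(\<lambda>n. exp (L (x (s n)))) \<longlonglongrightarrow> exp \<zeta>" by (intro tendsto_intros \<zeta>)
      moreover have "exp (L (x (s n))) = ?E (x (s n))" for n using x exp_L by (auto simp: U_def)
      ultimately have "(\<lambda>n. ?E (x (s n))) \<longlonglongrightarrow> exp \<zeta>" by simp
      moreover have "(\<lambda>n. ?E (x (s n))) \<longlonglongrightarrow> ?E a"
        by (rule continuous_on_tendsto_compose[OF contE xs]) auto
      ultimately have E_a: "?E a = exp \<zeta>" using LIMSEQ_unique by blast
      have "Im (exp \<zeta>) > 0"
        using \<zeta>(1) K(2) by (auto simp: S_def Im_exp intro!: mult_pos_pos sin_gt_zero)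
      then have "Im (?E a) > 0" using E_a by simp
      moreover have "?E a \<in> \<real>" if "Im a = 0"
      proof -
        have "a \<in> \<real>" using that complex_is_Real_iff by blast
        then show ?thesis by (auto intro!: Reals_mult Reals_add Reals_power Reals_divide prod_in_Reals exp_in_Reals)
      qed
      ultimately have "Im a \<noteq> 0" using complex_is_Real_iff by (metis less_irrefl)
      moreover have "Im a \<ge> 0"
        by (rule LIMSEQ_le_const[OF tendsto_Im[OF lim_x]]) (use x in \<open>auto simp: U_def intro: less_imp_le\<close>)
      ultimately have "Im a > 0" by simp
      then have "isCont L a" using DL DERIV_isCont by blast
      then have "(\<lambda>n. L (x (s n))) \<longlonglongrightarrow> L a" using xs isCont_tendsto_compose by blast
      then have "L a = \<zeta>" using \<zeta>(3) LIMSEQ_unique by blast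
      then show "a \<in> U \<inter> L -` K" using \<open>Im a > 0\<close> \<zeta>(1) K(2) by (auto simp: U_def)
    qed
    ultimately show ?thesis by (simp add: compact_eq_bounded_closed)
  qed
  have Ln_S: "Ln w \<in> S" if "Im w > 0" for w
    using that Im_Ln_pos_lt_imp[of w] by (auto simp: S_def)
  have "z0 \<in> U" using z0 Ln_S by (simp add: U_def L_z0)
  have nz: "deriv L z \<noteq> 0" if "z \<in> U" for z
    using that log_deriv_nonzero_upper_half_plane[OF l x0 _ neg] DERIV_imp_deriv[OF DL] by (auto simp: U_def)
  obtain s where s: "s holomorphic_on S" "s \<in> S \<rightarrow> U" "s (L z0) = z0" "\<And>w. w \<in> S \<Longrightarrow> L (s w) = w"
    using proper_local_biholomorphism_section[OF \<open>open U\<close> holL _ \<open>open S\<close>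
        convex_imp_simply_connected[OF \<open>convex S\<close>] nz proper \<open>z0 \<in> U\<close>]
    by (auto simp: U_def)
  show "\<exists>p. p holomorphic_on upper_half_plane \<and> p \<in> upper_half_plane \<rightarrow> upper_half_plane \<and>
          (\<forall>w\<in>upper_half_plane. ?E (p w) = w) \<and> p (?E z0) = z0"
  \<comment> \<open>\<open>Ln\<close> maps the upper half plane into the strip, so a section of
    \<open>L\<close> over the strip followed by nothing but \<open>exp (Ln w) = w\<close> yields a
    section of the partial product.\<close>
  proof (intro exI[of _ "\<lambda>w. s (Ln w)"] conjI ballI)
    have "Ln holomorphic_on upper_half_plane"
      by (intro holomorphic_intros) (auto simp: complex_nonpos_Reals_iff)
    moreover have "Ln ` upper_half_plane \<subseteq> S" using Ln_S by auto
    ultimately show "(\<lambda>w. s (Ln w)) holomorphic_on upper_half_plane"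
      using holomorphic_on_compose_gen[OF _ s(1), of Ln upper_half_plane]
      by (simp add: o_def)
    show "(\<lambda>w. s (Ln w)) \<in> upper_half_plane \<rightarrow> upper_half_plane"
      using s(2) Ln_S by (force simp: U_def)
    show "s (Ln (?E z0)) = z0" using s(3) L_z0 by simp
    fix w assume w: "w \<in> upper_half_plane"
    then have "s (Ln w) \<in> U" using s(2) Ln_S by auto
    then have "?E (s (Ln w)) = exp (L (s (Ln w)))" using exp_L by (auto simp: U_def)
    also have "\<dots> = exp (Ln w)" using s(4) Ln_S w by simp
    also have "\<dots> = w" using w by (intro exp_Ln) auto
    finally show "?E (s (Ln w)) = w" .
  qed
qed

section \<open>Passage to locally uniform limits\<close>

lemma uniform_limit_continuous_convergence:
  fixes f :: "'a::metric_space \<Rightarrow> 'b::metric_space"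
  assumes lim: "uniform_limit S F f sequentially" and S: "open S" "a \<in> S"
    and f: "continuous_on S f" and x: "x \<longlonglongrightarrow> a"
  shows "(\<lambda>n. F n (x n)) \<longlonglongrightarrow> f a"
proof -
  have xS: "eventually (\<lambda>n. x n \<in> S) sequentially"
    using topological_tendstoD[OF x S] .
  have fx: "(\<lambda>n. f (x n)) \<longlonglongrightarrow> f a"
    by (rule continuous_on_tendsto_compose[OF f x S(2) xS])
  show ?thesis
  proof (rule tendstoI)
    fix e :: real assume "e > 0"
    then have "e / 2 > 0" by simp
    from uniform_limitD[OF lim this] xS tendstoD[OF fx this]
    show "eventually (\<lambda>n. dist (F n (x n)) (f a) < e) sequentially"
    proof eventually_elim
      case (elim n)
      then show ?case using dist_triangle_half_l[of "F n (x n)" "f (x n)" e "f a"]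
        by (metis dist_commute dist_triangle_half_r)
    qed
  qed
qed

text \<open>The Cayley transform \<open>C\<close> takes the sections into the unit disc, where
  Montel's theorem applies. The danger is that their limit escapes to the boundary, that is, to the
  real axis or to infinity. By the maximum principle it would then be constant of modulus 1, but at
  \<open>f z0\<close> it has the interior value \<open>C z0\<close>.\<close>

lemma has_sections_limit:
  assumes sec: "eventually (\<lambda>n. has_sections (F n)) sequentially"
    and lim: "\<And>R. uniform_limit (ball 0 R) F f sequentially"
    and f: "continuous_on UNIV f"
  shows "has_sections f"
  unfolding has_sections_def
proof (intro allI impI, elim conjE)
  fix z0 assume z0: "Im z0 > 0" "Im (f z0) > 0"
  define C where "C = (\<lambda>z. (z - \<i>) / (z + \<i>))"
  have conv: "(\<lambda>n. F n (x n)) \<longlonglongrightarrow> f a" if "x \<longlonglongrightarrow> a" for x a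
    by (rule uniform_limit_continuous_convergence[OF lim[of "norm a + 1"] open_ball _ _ that])
       (use f continuous_on_subset in auto)
  have Fz0: "(\<lambda>n. F n z0) \<longlonglongrightarrow> f z0" by (rule conv) simp
  have "eventually (\<lambda>n. Im (F n z0) > 0) sequentially"
    using order_tendstoD(1)[OF tendsto_Im[OF Fz0]] z0 by blast
  then have "eventually (\<lambda>n. has_sections (F n) \<and> Im (F n z0) > 0) sequentially"
    using sec by eventually_elim auto
  then obtain N where N: "\<And>n. n \<ge> N \<Longrightarrow> has_sections (F n) \<and> Im (F n z0) > 0"
    by (auto simp: eventually_sequentially)
  define G where "G = (\<lambda>n. F (n + N))"
  \<comment> \<open>The arguments must be allowed to move, since \<open>G n\<close> will be
    evaluated at \<open>p n w\<close>, and the convergence must hold along the subsequence that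
    Montel's theorem selects.\<close>
  have convG: "(\<lambda>n. G (s n) (x n)) \<longlonglongrightarrow> f a" if "x \<longlonglongrightarrow> a" "strict_mono s" for x a s
  proof (rule uniform_limit_continuous_convergence[OF _ open_ball _ _ that(1)])
    have "filterlim (\<lambda>n. s n + N) sequentially sequentially"
      using filterlim_subseq[OF that(2)] by (rule filterlim_compose[OF filterlim_add_const_nat_at_top])
    then show "uniform_limit (ball 0 (norm a + 1)) (\<lambda>n. G (s n)) f sequentially"
      unfolding G_def by (rule filterlim_compose[OF lim])
  qed (use f continuous_on_subset in auto)
  have "\<exists>p. p holomorphic_on upper_half_plane \<and> p \<in> upper_half_plane \<rightarrow> upper_half_plane \<and>
           (\<forall>w\<in>upper_half_plane. G n (p w) = w) \<and> p (G n z0) = z0" for n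
    using N[of "n + N"] z0 unfolding G_def has_sections_def by auto
  then obtain p where p: "\<And>n. p n holomorphic_on upper_half_plane"
      "\<And>n. p n \<in> upper_half_plane \<rightarrow> upper_half_plane"
      "\<And>n w. Im w > 0 \<Longrightarrow> G n (p n w) = w" "\<And>n. p n (G n z0) = z0"
    by (metis mem_Collect_eq)
  have pos: "Im (p n w) > 0" if "Im w > 0" for n w
    using p(2)[of n] that by auto
  have nz: "z + \<i> \<noteq> 0" if "Im z > 0" for z
    using that by (auto simp: complex_eq_iff)
  have C_less: "norm (C z) < 1" if "Im z > 0" for z
  proof -
    have "(norm (z - \<i>))\<^sup>2 < (norm (z + \<i>))\<^sup>2"
      using that unfolding cmod_power2 by (simp add: power2_eq_square algebra_simps)
    then have "norm (z - \<i>) < norm (z + \<i>)" by (simp add: power2_less_imp_less)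
    then show ?thesis using nz[OF that] by (simp add: C_def norm_divide)
  qed
  define q where "q = (\<lambda>n w. C (p n w))"
  have q_hol: "q n holomorphic_on upper_half_plane" for n
    unfolding q_def C_def using nz pos by (intro holomorphic_intros p) auto
  have q_le: "norm (q n w) \<le> 1" if "Im w > 0" for n w
    using C_less[OF pos[OF that]] by (auto simp: q_def intro: less_imp_le)
  obtain h s where h: "h holomorphic_on upper_half_plane" "strict_mono s"
      "\<And>w. w \<in> upper_half_plane \<Longrightarrow> (\<lambda>n. q (s n) w) \<longlonglongrightarrow> h w"
      "\<And>K. compact K \<Longrightarrow> K \<subseteq> upper_half_plane \<Longrightarrow> uniform_limit K (q \<circ> s) h sequentially"
  proof (rule Montel[OF open_upper_half_plane, of "range q" q])
    show "\<exists>B. \<forall>h\<in>range q. \<forall>z\<in>K. norm (h z) \<le> B" if "compact K" "K \<subseteq> upper_half_plane" for K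
      using q_le that by (intro exI[of _ 1]) auto
  qed (use q_hol that in auto)
  have h_le: "norm (h w) \<le> 1" if "Im w > 0" for w
    by (rule LIMSEQ_le_const2[OF tendsto_norm[OF h(3)]]) (use that q_le in auto)
  define w0 where "w0 = f z0"
  \<comment> \<open>The sections are normalised at \<open>G n z0\<close>, which merely tends to
    \<open>w0\<close>; uniform convergence near \<open>w0\<close> carries the normalisation over to
    the limit.\<close>
  have h_w0: "h w0 = C z0"
  proof -
    obtain e where e: "e > 0" "cball w0 e \<subseteq> upper_half_plane"
      using open_upper_half_plane z0 open_contains_cball unfolding w0_def by (metis mem_Collect_eq)
    have u: "uniform_limit (ball w0 e) (q \<circ> s) h sequentially"
      using h(4)[OF compact_cball e(2)] by (rule uniform_limit_on_subset) auto
    have c: "continuous_on (ball w0 e) h"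
      using h(1) e by (meson ball_subset_cball continuous_on_subset holomorphic_on_imp_continuous_on)
    have t: "(\<lambda>n. G (s n) z0) \<longlonglongrightarrow> w0" unfolding w0_def by (rule convG) (use h in auto)
    have "(\<lambda>n. (q \<circ> s) n (G (s n) z0)) \<longlonglongrightarrow> h w0"
      by (rule uniform_limit_continuous_convergence[OF u open_ball _ c t]) (use e(1) in simp)
    then have "(\<lambda>n. C z0) \<longlonglongrightarrow> h w0" by (simp add: q_def p)
    then show ?thesis by (simp add: LIMSEQ_const_iff)
  qed
  have h_less: "norm (h w) < 1" if w: "Im w > 0" for w
  proof (rule ccontr)
    assume "\<not> norm (h w) < 1"
    then have "\<And>z. z \<in> upper_half_plane \<Longrightarrow> norm (h z) \<le> norm (h w)"
      using h_le by (force intro: order_trans)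
    then have "h constant_on upper_half_plane"
      using maximum_modulus_principle[OF h(1) open_upper_half_plane
          convex_connected[OF convex_upper_half_plane] open_upper_half_plane] w by blast
    then have "h w = h w0" using w z0 unfolding constant_on_def w0_def by fastforce
    then show False using C_less[OF z0(1)] h_w0 \<open>\<not> norm (h w) < 1\<close> by simp
  qed
  \<comment> \<open>The inverse of the Cayley transform.\<close>
  define D where "D = (\<lambda>v. \<i> * (1 + v) / (1 - v))"
  have D_C: "D (C z) = z" if "Im z > 0" for z
  proof -
    have "1 + C z = 2 * z / (z + \<i>)" "1 - C z = 2 * \<i> / (z + \<i>)"
      using nz[OF that] by (simp_all add: C_def field_simps)
    then show ?thesis using nz[OF that] by (simp add: D_def)
  qed
  have D_pos: "Im (D v) > 0" if "norm v < 1" for v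
  proof -
    have "v \<noteq> 1" using that by auto
    then have *: "(Re (1 - v))\<^sup>2 + (Im (1 - v))\<^sup>2 > 0"
      by (metis cmod_power2 eq_iff_diff_eq_0 zero_less_norm_iff zero_less_power)
    have "(Re v)\<^sup>2 + (Im v)\<^sup>2 < 1"
      using that by (metis cmod_power2 norm_ge_zero power_less_one_iff zero_neq_numeral zero_less_numeral)
    then have "(1 + Re v) * (1 - Re v) - Im v * Im v > 0"
      by (simp add: algebra_simps power2_eq_square)
    then show ?thesis using * by (simp add: D_def Im_divide)
  qed
  have h_ne: "1 - h w \<noteq> 0" if "Im w > 0" for w
    using h_less[OF that] by auto
  show "\<exists>p. p holomorphic_on upper_half_plane \<and> p \<in> upper_half_plane \<rightarrow> upper_half_plane \<and>
          (\<forall>w\<in>upper_half_plane. f (p w) = w) \<and> p (f z0) = z0"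
  proof (intro exI[of _ "\<lambda>w. D (h w)"] conjI ballI)
    show "(\<lambda>w. D (h w)) holomorphic_on upper_half_plane"
      unfolding D_def using h_ne by (intro holomorphic_intros h) auto
    show "(\<lambda>w. D (h w)) \<in> upper_half_plane \<rightarrow> upper_half_plane"
      using D_pos h_less by auto
    show "D (h (f z0)) = z0" using h_w0 D_C z0 by (simp add: w0_def)
    fix w assume w: "w \<in> upper_half_plane"
    have "(\<lambda>n. D (q (s n) w)) \<longlonglongrightarrow> D (h w)"
      unfolding D_def using h(3)[OF w] h_ne w by (intro tendsto_intros) auto
    then have "(\<lambda>n. p (s n) w) \<longlonglongrightarrow> D (h w)" using D_C pos w by (simp add: q_def)
    then have "(\<lambda>n. G (s n) (p (s n) w)) \<longlonglongrightarrow> f (D (h w))" by (rule convG) (fact h)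
    then show "f (D (h w)) = w" using w by (simp add: p LIMSEQ_const_iff)
  qed
qed

section \<open>Continuation across the real axis\<close>

lemma on_reals_has_real_derivative:
  assumes "(f has_field_derivative D) (at (complex_of_real x))"
  shows "(on_reals f has_real_derivative Re D) (at x)"
  using has_field_derivative_Re[OF has_vector_derivative_real_field[OF assms]]
  by (simp add: on_reals_def[abs_def])

text \<open>A section through a point just above the real axis is the local inverse of
  \<open>f\<close> there, by injectivity on a small disc. The identity theorem carries this
  agreement along the whole half line, and reflection continues the section across its image.
  Univalence is immediate from \<open>f (p w) = w\<close>.\<close>

lemma has_sections_extends_to_univalent_Pick_function:
  fixes f :: "complex \<Rightarrow> complex" and \<beta> :: real
  assumes hol: "f holomorphic_on UNIV" and sym: "\<And>z. f (cnj z) = cnj (f z)"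
    and sec: "has_sections f"
    and der: "\<And>x. x > \<beta> \<Longrightarrow> Re (deriv f (of_real x)) > 0"
  shows "extends_to_univalent_Pick_function (the_inv_into {\<beta><..} (on_reals f)) (on_reals f ` {\<beta><..})"
proof -
  define g where "g = on_reals f"
  have f_real: "f (of_real x) = of_real (g x)" for x
    using sym[of "of_real x"] by (simp add: g_def on_reals_def complex_eq_iff)
  have DERIV_f: "(f has_field_derivative deriv f z) (at z)" for z
    using hol holomorphic_derivI[OF _ open_UNIV] by blast
  have contf: "continuous_on UNIV f" using hol holomorphic_on_imp_continuous_on by blast
  have DERIV_g: "(g has_real_derivative Re (deriv f (of_real x))) (at x)" for x
    unfolding g_def by (rule on_reals_has_real_derivative[OF DERIV_f])
  have contg: "continuous_on UNIV g"
    using DERIV_g DERIV_isCont continuous_at_imp_continuous_on by blast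
  have g_less: "g x < g y" if "\<beta> < x" "x < y" for x y
    by (rule DERIV_pos_imp_increasing[OF that(2)]) (use that DERIV_g der in force)
  have g_inj: "inj_on g {\<beta><..}"
    by (rule linorder_inj_onI') (use g_less in force)

  txt \<open>\<open>chart x r e h\<close>: \<open>h\<close> is the local inverse of \<open>f\<close> from the disc of radius \<open>e\<close> about
    \<open>f x\<close> into the disc of radius \<open>r\<close> about \<open>x\<close>.\<close>
  define chart where "chart = (\<lambda>x r e h. 0 < r \<and> r \<le> x - \<beta> \<and> inj_on f (ball (of_real x) r) \<and> 0 < e \<and>
      h holomorphic_on ball (of_real (g x)) e \<and>
      (\<forall>w\<in>ball (of_real (g x)) e. h w \<in> ball (of_real x) r \<and> f (h w) = w))"
  have chart_ex: "\<exists>r e h. chart x r e h" if "x > \<beta>" for x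
  proof -
    have "deriv f (of_real x) \<noteq> 0" using der[OF that] by auto
    then obtain r0 where r0: "r0 > 0" "inj_on f (ball (of_real x) r0)"
      using has_complex_derivative_locally_injective[OF hol] by (metis UNIV_I open_UNIV)
    define r where "r = min r0 (x - \<beta>)"
    have r: "0 < r" "r \<le> x - \<beta>" "inj_on f (ball (of_real x) r)"
      using r0 that by (auto simp: r_def intro: inj_on_subset)
    have holr: "f holomorphic_on ball (of_real x) r" using hol holomorphic_on_subset by blast
    obtain h where h: "h holomorphic_on f ` ball (of_real x) r"
        "\<And>z. z \<in> ball (of_real x) r \<Longrightarrow> h (f z) = z"
      using holomorphic_has_inverse[OF holr open_ball r(3)] by metis
    have "open (f ` ball (of_real x) r)" by (rule open_mapping_thm3[OF holr open_ball r(3)])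
    moreover have "of_real (g x) \<in> f ` ball (of_real x) r"
      using r(1) by (auto simp: f_real[symmetric])
    ultimately obtain e where e: "e > 0" "ball (of_real (g x)) e \<subseteq> f ` ball (of_real x) r"
      by (meson openE)
    have "chart x r e h"
      unfolding chart_def using r e h by (force intro: holomorphic_on_subset)
    then show ?thesis by blast
  qed
  have chart_inv: "h (f z) = z"
    if "chart x r e h" "z \<in> ball (of_real x) r" "f z \<in> ball (of_real (g x)) e" for x r e h z
    using that inj_onD[of f "ball (of_real x) r"] unfolding chart_def by blast

  \<comment> \<open>Any point to the right of \<beta> would serve as a starting point.\<close>
  define x0 where "x0 = \<beta> + 1"
  have x0: "x0 > \<beta>" by (simp add: x0_def)
  obtain r0 e0 h0 where chart0: "chart x0 r0 e0 h0" using chart_ex[OF x0] by blast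
  obtain z0 where z0: "Im z0 > 0" "Im (f z0) > 0" "z0 \<in> ball (of_real x0) r0"
      "f z0 \<in> ball (of_real (g x0)) e0"
  proof -
    define \<gamma> where "\<gamma> = (\<lambda>z. f (of_real x0 + \<i> * z))"
    have "((\<lambda>z. f (of_real x0 + \<i> * z)) has_field_derivative deriv f (of_real x0) * \<i>) (at (of_real 0))"
      by (rule DERIV_chain2[where g = "\<lambda>z. of_real x0 + \<i> * z"])
         (use DERIV_f[of "of_real x0"] in \<open>auto intro!: derivative_eq_intros\<close>)
    \<comment> \<open>The derivative at 0 is the real part of \<open>deriv f x0\<close>, which is
      positive. Hence points just above \<open>x0\<close> are mapped into the upper half
      plane.\<close>
    then have "((\<lambda>t. Im (f (of_real x0 + \<i> * of_real t))) has_real_derivative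
                 Im (deriv f (of_real x0) * \<i>)) (at 0)"
      by (intro has_field_derivative_Im has_vector_derivative_real_field)
    then obtain d where d: "d > 0" "\<And>t. 0 < t \<Longrightarrow> t < d \<Longrightarrow> Im (f (of_real x0 + \<i> * of_real t)) > 0"
      using DERIV_pos_inc_right[of "\<lambda>t. Im (f (of_real x0 + \<i> * of_real t))" _ 0] der[OF x0]
      by (auto simp: f_real)
    have "isCont f (of_real x0)" using DERIV_f DERIV_isCont by blast
    moreover have "e0 > 0" "r0 > 0" using chart0 by (auto simp: chart_def)
    ultimately obtain d' where d': "d' > 0"
        "\<And>z. dist z (of_real x0) < d' \<Longrightarrow> dist (f z) (of_real (g x0)) < e0"
      unfolding continuous_at_eps_delta f_real by blast
    define t where "t = min d (min d' r0) / 2"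
    have t: "0 < t" "t < d" "t < d'" "t < r0" using d d' \<open>r0 > 0\<close> by (auto simp: t_def)
    have dist: "dist (of_real x0 + \<i> * of_real t) (of_real x0) = t" using t by (simp add: dist_norm norm_mult)
    have "dist (f (of_real x0 + \<i> * of_real t)) (of_real (g x0)) < e0"
      by (rule d'(2)) (simp only: dist t)
    then show ?thesis
      by (intro that[of "of_real x0 + \<i> * of_real t"])
         (use t d dist in \<open>auto simp: dist_commute\<close>)
  qed
  obtain p where p: "p holomorphic_on upper_half_plane" "p \<in> upper_half_plane \<rightarrow> upper_half_plane"
      "\<And>w. Im w > 0 \<Longrightarrow> f (p w) = w" "p (f z0) = z0"
    using sec z0 unfolding has_sections_def by (metis mem_Collect_eq)
  have contp: "isCont p w" if "Im w > 0" for w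
    using p(1) that open_upper_half_plane holomorphic_on_imp_continuous_on continuous_on_eq_continuous_at by blast

  have p_eq_h: "\<forall>w\<in>ball (of_real (g x)) e \<inter> upper_half_plane. p w = h w"
    if c: "chart x r e h" and s: "open s" "s \<noteq> {}" "s \<subseteq> ball (of_real (g x)) e \<inter> upper_half_plane"
      and ps: "\<And>w. w \<in> s \<Longrightarrow> p w \<in> ball (of_real x) r" for x r e h s
  proof
    fix w assume w: "w \<in> ball (of_real (g x)) e \<inter> upper_half_plane"
    show "p w = h w"
    proof (rule analytic_continuation_open[OF s(1) _ s(2) _ s(3) _ _ _ w])
      show "open (ball (complex_of_real (g x)) e \<inter> upper_half_plane)"
        by (intro open_Int open_ball open_upper_half_plane)
      show "connected (ball (complex_of_real (g x)) e \<inter> upper_half_plane)"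
        by (intro convex_connected convex_Int convex_ball convex_upper_half_plane)
      show "p holomorphic_on ball (of_real (g x)) e \<inter> upper_half_plane"
        by (rule holomorphic_on_subset[OF p(1)]) auto
      show "h holomorphic_on ball (of_real (g x)) e \<inter> upper_half_plane"
        by (rule holomorphic_on_subset[of h "ball (of_real (g x)) e"]) (use c in \<open>auto simp: chart_def\<close>)
      fix w assume "w \<in> s"
      then have "p w \<in> ball (of_real x) r" "f (p w) = w" "w \<in> ball (of_real (g x)) e"
        using ps p(3) s(3) by auto
      then show "p w = h w" using chart_inv[OF c, of "p w"] by simp
    qed
  qed

  txt \<open>The set where \<open>p\<close> has the right boundary value is open and closed, as membership
    in it means that \<open>p\<close> agrees with a local inverse of \<open>f\<close>.\<close>
  define P where "P = (\<lambda>x. (p \<longlongrightarrow> of_real x) (at (of_real (g x)) within upper_half_plane))"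
  have P_iff: "P y \<longleftrightarrow> (\<forall>w\<in>ball (of_real (g x)) e \<inter> upper_half_plane. p w = h w)"
    if c: "chart x r e h" and y: "of_real y \<in> ball (of_real x :: complex) r"
      "complex_of_real (g y) \<in> ball (of_real (g x)) e" for x r e h y
  proof
    assume "P y"
    have "eventually (\<lambda>w. p w \<in> ball (of_real x) r) (at (of_real (g y)) within upper_half_plane)"
      using topological_tendstoD[OF \<open>P y\<close>[unfolded P_def] open_ball y(1)] .
    then obtain d where d: "d > 0"
      "\<And>w. Im w > 0 \<Longrightarrow> w \<noteq> of_real (g y) \<Longrightarrow> dist w (of_real (g y)) < d \<Longrightarrow> p w \<in> ball (of_real x) r"
      unfolding eventually_at by blast
    define s where "s = ball (of_real (g y)) d \<inter> ball (of_real (g x)) e \<inter> upper_half_plane"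
    have "open s" unfolding s_def by (intro open_Int open_ball open_upper_half_plane)
    moreover have "s \<noteq> {}"
    proof -
      have "open (ball (of_real (g y)) d \<inter> ball (complex_of_real (g x)) e)" by blast
      moreover have "of_real (g y) \<in> ball (of_real (g y)) d \<inter> ball (complex_of_real (g x)) e"
        using d y by auto
      ultimately obtain \<epsilon> where \<epsilon>: "\<epsilon> > 0" "ball (of_real (g y)) \<epsilon> \<subseteq> ball (of_real (g y)) d \<inter> ball (complex_of_real (g x)) e"
        by (meson openE)
      have "of_real (g y) + \<i> * of_real (\<epsilon> / 2) \<in> ball (of_real (g y)) \<epsilon>"
        using \<epsilon>(1) by (simp add: dist_norm norm_mult)
      then have "of_real (g y) + \<i> * of_real (\<epsilon> / 2) \<in> s" using \<epsilon> unfolding s_def by auto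
      then show ?thesis by blast
    qed
    moreover have "p w \<in> ball (of_real x) r" if "w \<in> s" for w
    proof -
      have "w \<noteq> of_real (g y)" using that by (auto simp: s_def)
      then show ?thesis using d(2)[of w] that by (auto simp: s_def dist_commute)
    qed
    ultimately show "\<forall>w\<in>ball (of_real (g x)) e \<inter> upper_half_plane. p w = h w"
      using p_eq_h[OF c, of s] unfolding s_def by blast
  next
    assume eq: "\<forall>w\<in>ball (of_real (g x)) e \<inter> upper_half_plane. p w = h w"
    have "isCont h (of_real (g y))"
      using c y(2) holomorphic_on_imp_continuous_on continuous_on_eq_continuous_at[OF open_ball]
      unfolding chart_def by blast
    moreover have "h (of_real (g y)) = of_real y"
      using chart_inv[OF c y(1)] y(2) by (simp add: f_real)
    ultimately have "(h \<longlongrightarrow> of_real y) (at (of_real (g y)) within upper_half_plane)"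
      using isCont_def tendsto_within_subset by (metis subset_UNIV)
    moreover have "eventually (\<lambda>w. h w = p w) (at (of_real (g y)) within upper_half_plane)"
      using eventually_at_in_open'[OF open_ball y(2), THEN eventually_at_topological[THEN iffD1]]
      unfolding eventually_at_topological using eq y(2) by (metis IntI open_ball)
    ultimately show "P y" unfolding P_def by (rule Lim_transform_eventually)
  qed
  have P_x0: "P x0"
  proof -
    have "isCont p (f z0)" by (rule contp) (fact z0)
    then have "eventually (\<lambda>w. p w \<in> ball (of_real x0) r0) (at (f z0))"
      using z0(3) p(4) topological_tendstoD[OF _ open_ball] unfolding isCont_def by metis
    then obtain T where T: "open T" "f z0 \<in> T" "\<And>w. w \<in> T \<Longrightarrow> w \<noteq> f z0 \<Longrightarrow> p w \<in> ball (of_real x0) r0"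
      unfolding eventually_at_topological by blast
    define s where "s = T \<inter> ball (of_real (g x0)) e0 \<inter> upper_half_plane"
    have "open s" unfolding s_def by (intro open_Int open_ball open_upper_half_plane T)
    moreover have "s \<noteq> {}" using T z0 by (auto simp: s_def)
    moreover have "p w \<in> ball (of_real x0) r0" if "w \<in> s" for w
      using T(3)[of w] z0 p(4) that by (cases "w = f z0") (auto simp: s_def)
    ultimately have "\<forall>w\<in>ball (of_real (g x0)) e0 \<inter> upper_half_plane. p w = h0 w"
      using p_eq_h[OF chart0, of s] unfolding s_def by blast
    moreover have "0 < r0" "0 < e0" using chart0 by (auto simp: chart_def)
    ultimately show ?thesis using P_iff[OF chart0, of x0] by simp
  qed
  have P_all: "P x" if "x > \<beta>" for x
  proof (rule connected_induction_simple[of "{\<beta><..}" x0 x P])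
    show "\<exists>T. openin (top_of_set {\<beta><..}) T \<and> a \<in> T \<and> (\<forall>x\<in>T. \<forall>y\<in>T. P x \<longrightarrow> P y)" if a: "a \<in> {\<beta><..}" for a
    proof -
      have "a > \<beta>" using a by simp
      then obtain r e h where c: "chart a r e h" using chart_ex by blast
      define T where "T = {\<beta><..} \<inter> (ball a r \<inter> g -` ball (g a) e)"
      have "open (g -` ball (g a) e)" using contg open_vimage by blast
      then have "openin (top_of_set {\<beta><..}) T" unfolding T_def by (intro openin_open_Int open_Int open_ball)
      moreover have "a \<in> T" using a c by (auto simp: T_def chart_def)
      moreover have "P y \<longleftrightarrow> (\<forall>w\<in>ball (of_real (g a)) e \<inter> upper_half_plane. p w = h w)"
        if "y \<in> T" for y
        using P_iff[OF c, of y] that by (simp add: T_def)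
      ultimately show ?thesis by (intro exI[of _ T] conjI) auto
    qed
  qed (use x0 that P_x0 in auto)

  define \<psi> where "\<psi> = the_inv_into {\<beta><..} g"
  have \<psi>: "\<psi> (g x) = x" if "x > \<beta>" for x
    unfolding \<psi>_def using the_inv_into_f_f[OF g_inj] that by simp
  \<comment> \<open>Schwarz reflection. At real points outside the image of \<open>g\<close> the
    value of \<psi> is unspecified, which is harmless because analyticity on the real axis is
    claimed on that image only.\<close>
  define P' where "P' = (\<lambda>w. if Im w > 0 then p w else if Im w < 0 then cnj (p (cnj w)) else of_real (\<psi> (Re w)))"
  have analytic_real: "\<exists>e>0. P' holomorphic_on ball (of_real (g x)) e" if x: "x > \<beta>" for x
  proof -
    obtain r e h where c: "chart x r e h" using chart_ex[OF x] by blast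
    have re: "0 < r" "0 < e" "r \<le> x - \<beta>" "inj_on f (ball (of_real x) r)"
      "h holomorphic_on ball (of_real (g x)) e" using c by (auto simp: chart_def)
    have h: "h w \<in> ball (of_real x) r" "f (h w) = w" if "w \<in> ball (of_real (g x)) e" for w
      using c that by (auto simp: chart_def)
    have ph: "p w = h w" if "w \<in> ball (of_real (g x)) e" "Im w > 0" for w
      using P_iff[OF c, of x] P_all[OF x] re that by auto
    have cnj_ball: "cnj w \<in> ball (of_real y) d \<longleftrightarrow> w \<in> ball (of_real y) d" for w y d
      by (metis (no_types) complex_cnj_complex_of_real complex_cnj_diff complex_mod_cnj dist_norm mem_ball)
    have h_cnj: "h w = cnj (h (cnj w))" if w: "w \<in> ball (of_real (g x)) e" for w
    proof -
      have w': "cnj w \<in> ball (of_real (g x)) e" using w cnj_ball by blast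
      have "cnj (h (cnj w)) \<in> ball (of_real x) r" using h(1)[OF w'] cnj_ball by blast
      moreover have "f (cnj (h (cnj w))) = w" by (simp add: sym h(2)[OF w'])
      ultimately show ?thesis using chart_inv[OF c, of "cnj (h (cnj w))"] w by simp
    qed
    have "P' w = h w" if w: "w \<in> ball (of_real (g x)) e" for w
    proof -
      consider "Im w > 0" | "Im w < 0" | "Im w = 0" by linarith
      then show ?thesis
      proof cases
        case 1 then show ?thesis using ph w by (simp add: P'_def)
      next
        case 2
        then have "P' w = cnj (p (cnj w))" by (simp add: P'_def)
        also have "p (cnj w) = h (cnj w)" using 2 w cnj_ball by (intro ph) auto
        finally show ?thesis using h_cnj[OF w] by simp
      next
        case 3
        then have wr: "w = of_real (Re w)" by (simp add: complex_eq_iff)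
        then have "cnj w = w" by (metis complex_cnj_complex_of_real)
        then have "h w = cnj (h w)" using h_cnj[OF w] by simp
        then have hr: "h w = of_real (Re (h w))" by (simp add: complex_eq_iff)
        have "dist (complex_of_real x) (of_real (Re (h w))) < r" using h(1)[OF w] hr by (metis mem_ball)
        then have "\<bar>x - Re (h w)\<bar> < r" by (simp only: dist_of_real dist_real_def)
        \<comment> \<open>The bound \<open>r \<le> x - \<beta>\<close> in \<open>chart\<close>
          secures that the local inverse takes its real values where \<psi> inverts
          \<open>g\<close>.\<close>
        then have "Re (h w) > \<beta>" using re(3) by linarith
        moreover have "complex_of_real (g (Re (h w))) = of_real (Re w)"
          using h(2)[OF w] hr wr f_real by metis
        then have "g (Re (h w)) = Re w" using of_real_eq_iff by blast
        ultimately have "\<psi> (Re w) = Re (h w)" using \<psi> by metis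
        then show ?thesis using 3 hr by (simp add: P'_def)
      qed
    qed
    then have "P' holomorphic_on ball (of_real (g x)) e" using re(5) holomorphic_cong by (metis (no_types, lifting))
    then show ?thesis using re by blast
  qed
  have hol_P': "P' holomorphic_on upper_half_plane"
    using p(1) by (rule holomorphic_transform) (simp add: P'_def)
  show ?thesis
    unfolding extends_to_univalent_Pick_function_def g_def[symmetric] \<psi>_def[symmetric]
  proof (intro exI[of _ P'] conjI ballI)
    show "Pick_function P'"
    proof -
      have "Im (P' z) \<ge> 0" if "Im z > 0" for z
        using p(2) that by (auto simp: P'_def Pi_iff intro: less_imp_le)
      then show ?thesis unfolding Pick_function_def using hol_P' by simp
    qed
    show "inj_on P' upper_half_plane"
      by (rule inj_onI) (metis P'_def mem_Collect_eq p(3))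
    have "P' analytic_on upper_half_plane"
      using hol_P' analytic_on_open open_upper_half_plane by blast
    moreover have "P' analytic_on complex_of_real ` g ` {\<beta><..}"
      unfolding analytic_on_def using analytic_real by auto
    ultimately show "P' analytic_on upper_half_plane \<union> complex_of_real ` g ` {\<beta><..}"
      by (simp add: analytic_on_Un)
    show "P' (of_real x) = of_real (\<psi> x)" for x by (simp add: P'_def)
  qed
qed

section \<open>Functions with convex logarithmic derivative\<close>

text \<open>The point \<open>y\<close> is a convex combination of \<open>x\<close> and
  \<open>z\<close>, so with a negative value at \<open>x\<close> and none at \<open>y\<close> the
  value at \<open>z\<close> has to be positive.\<close>

lemma convex_on_crossing_pos:
  fixes \<phi> :: "real \<Rightarrow> real"
  assumes "convex_on S \<phi>" "x \<in> S" "z \<in> S" "x < y" "y < z" "\<phi> x < 0" "\<phi> y \<ge> 0"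
  shows "\<phi> z > 0"
proof -
  define t where "t = (z - y) / (z - x)"
  have t: "0 < t" "t < 1" using assms by (auto simp: t_def field_simps)
  have "t * (z - x) = z - y" using assms by (simp add: t_def)
  then have y: "y = (1 - t) * z + t * x" by (simp add: algebra_simps)
  have "\<phi> y \<le> (1 - t) * \<phi> z + t * \<phi> x"
    using convex_onD[OF assms(1), of t z x] assms t unfolding y by simp
  moreover have "t * \<phi> x < 0" using t assms by (simp add: mult_pos_neg)
  ultimately have "(1 - t) * \<phi> z > 0" using assms by linarith
  then show ?thesis using t by (simp add: zero_less_mult_iff)
qed

lemma convex_on_crossing_neg:
  fixes \<phi> :: "real \<Rightarrow> real"
  assumes "convex_on S \<phi>" "x \<in> S" "z \<in> S" "x < y" "y < z" "\<phi> x < 0" "\<phi> z \<le> 0"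
  shows "\<phi> y < 0"
  using convex_on_crossing_pos[OF assms(1-6)] assms(7) by force

lemma convex_on_crossing_pos_left:
  fixes \<phi> :: "real \<Rightarrow> real"
  assumes "convex_on S \<phi>" "x \<in> S" "z \<in> S" "x < y" "y < z" "\<phi> z < 0" "\<phi> y \<ge> 0"
  shows "\<phi> x > 0"
proof -
  have "convex_on (uminus ` S) (\<lambda>u. \<phi> (- u))"
  proof (rule convex_onI)
    fix t u v assume *: "0 < t" "t < (1::real)" "u \<in> uminus ` S" "v \<in> uminus ` S"
    have "- ((1 - t) *\<^sub>R u + t *\<^sub>R v) = (1 - t) *\<^sub>R (- u) + t *\<^sub>R (- v)" by simp
    then show "\<phi> (- ((1 - t) *\<^sub>R u + t *\<^sub>R v)) \<le> (1 - t) * \<phi> (- u) + t * \<phi> (- v)"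
      using convex_onD[OF assms(1), of t "- u" "- v"] * by auto
  next
    show "convex (uminus ` S)"
      using assms(1) by (simp add: convex_on_imp_convex convex_negations)
  qed
  from convex_on_crossing_pos[OF this, of "- z" "- x" "- y"] assms show ?thesis by auto
qed

text \<open>Three sample signs determine everything: a convex \<phi> that is positive, negative,
  positive at \<open>a1 < a2 < a3\<close> has exactly two zeros, is negative between them and
  positive outside. The left zero is not a local minimum point of \<open>g\<close>, the right one
  is.\<close>

lemma convex_log_derivative_shape:
  fixes g \<phi> :: "real \<Rightarrow> real"
  assumes pos: "\<And>x. x > 0 \<Longrightarrow> g x > 0"
    and deriv: "\<And>x. x > 0 \<Longrightarrow> (g has_real_derivative \<phi> x * g x) (at x)"
    and cont: "continuous_on {0<..} \<phi>" and conv: "convex_on {0<..} \<phi>"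
    and a: "0 < a1" "a1 < a2" "a2 < a3" "\<phi> a1 > 0" "\<phi> a2 < 0" "\<phi> a3 > 0"
  obtains \<beta> where "a2 < \<beta>" "\<And>x. x > \<beta> \<Longrightarrow> \<phi> x > 0" "strict_antimono_on {a2<..<\<beta>} g"
    "\<And>x. is_pos_local_min g x \<longleftrightarrow> x = \<beta>" "g ` {\<beta><..} = {g \<beta><..}"
proof -
  have zero: "\<exists>x. u < x \<and> x < v \<and> \<phi> x = 0"
    if uv: "0 < u" "u < v" "\<phi> u * \<phi> v < 0" for u v
  proof -
    have c: "continuous_on {u..v} \<phi>" by (rule continuous_on_subset[OF cont]) (use uv in auto)
    have "\<exists>x\<ge>u. x \<le> v \<and> \<phi> x = 0"
    proof (cases "\<phi> u < 0")
      case True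
      then have "\<phi> v > 0" using uv(3) by (auto simp: mult_less_0_iff)
      then show ?thesis using IVT'[of \<phi> u 0 v] c True uv(2) by auto
    next
      case False
      then have "\<phi> u > 0" "\<phi> v < 0" using uv(3) by (auto simp: mult_less_0_iff)
      then show ?thesis using IVT2'[of \<phi> v 0 u] c uv(2) by auto
    qed
    then obtain x where "u \<le> x" "x \<le> v" "\<phi> x = 0" by blast
    moreover have "\<phi> u \<noteq> 0" "\<phi> v \<noteq> 0" using uv(3) by auto
    ultimately have "u \<noteq> x" "x \<noteq> v" by auto
    then show ?thesis using \<open>u \<le> x\<close> \<open>x \<le> v\<close> \<open>\<phi> x = 0\<close> by (intro exI[of _ x]) auto
  qed
  obtain \<alpha> where \<alpha>: "a1 < \<alpha>" "\<alpha> < a2" "\<phi> \<alpha> = 0"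
    using zero[of a1 a2] a by (auto simp: mult_pos_neg)
  obtain \<beta> where \<beta>: "a2 < \<beta>" "\<beta> < a3" "\<phi> \<beta> = 0"
    using zero[of a2 a3] a by (auto simp: mult_neg_pos)
  have right: "\<phi> x > 0" if "x > \<beta>" for x
    using convex_on_crossing_pos[OF conv, of a2 x \<beta>] a \<beta> that by auto
  have left: "\<phi> x > 0" if "0 < x" "x < \<alpha>" for x
    using convex_on_crossing_pos_left[OF conv, of x a2 \<alpha>] a \<alpha> that by auto
  have mid: "\<phi> x < 0" if x: "\<alpha> < x" "x < \<beta>" for x
  proof -
    consider "x < a2" | "x = a2" | "x > a2" by linarith
    then show ?thesis
    proof cases
      case 1
      then have "\<phi> x \<ge> 0 \<Longrightarrow> \<phi> \<alpha> > 0"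
        using convex_on_crossing_pos_left[OF conv, of \<alpha> a2 x] a \<alpha> x by auto
      then show ?thesis using \<alpha>(3) by force
    next
      case 3
      then show ?thesis using convex_on_crossing_neg[OF conv, of a2 \<beta> x] a \<beta> x by auto
    qed (use a in auto)
  qed
  have contg: "continuous_on {0<..} g"
    by (rule DERIV_continuous_on) (use deriv in \<open>auto intro: has_field_derivative_at_within\<close>)
  have cg: "continuous_on {u..v} g" if "0 < u" for u v
    by (rule continuous_on_subset[OF contg]) (use that in auto)
  have inc: "g u < g v" if uv: "0 < u" "u < v" "\<And>x. u < x \<Longrightarrow> x < v \<Longrightarrow> \<phi> x > 0" for u v
  proof (rule DERIV_pos_imp_increasing_open[OF uv(2)])
    show "\<exists>y. (g has_real_derivative y) (at x) \<and> 0 < y" if "u < x" "x < v" for x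
      using deriv[of x] pos[of x] uv(1) that uv(3)[of x] by (intro exI[of _ "\<phi> x * g x"]) auto
  qed (use cg uv in auto)
  have dec: "g u > g v" if uv: "0 < u" "u < v" "\<And>x. u < x \<Longrightarrow> x < v \<Longrightarrow> \<phi> x < 0" for u v
  proof (rule DERIV_neg_imp_decreasing_open[OF uv(2)])
    show "\<exists>y. (g has_real_derivative y) (at x) \<and> y < 0" if "u < x" "x < v" for x
      using deriv[of x] pos[of x] uv(1) that uv(3)[of x]
      by (intro exI[of _ "\<phi> x * g x"]) (auto simp: mult_neg_pos)
  qed (use cg uv in auto)
  show thesis
  proof (rule that[of \<beta>])
    show "strict_antimono_on {a2<..<\<beta>} g"
    proof (rule monotone_onI)
      fix u v assume uv: "u \<in> {a2<..<\<beta>}" "v \<in> {a2<..<\<beta>}" "u < v"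
      show "g u > g v" by (rule dec) (use uv a \<alpha> mid in auto)
    qed
    show "is_pos_local_min g x \<longleftrightarrow> x = \<beta>" for x
    proof
      assume "x = \<beta>"
      have "\<beta> \<in> {\<alpha><..<a3}" using \<alpha> \<beta> by auto
      then have "eventually (\<lambda>y. y \<in> {\<alpha><..<a3}) (nhds \<beta>)"
        by (intro eventually_nhds_in_open) auto
      then have "eventually (\<lambda>y. g \<beta> \<le> g y) (nhds \<beta>)"
      proof eventually_elim
        case (elim y)
        consider "y < \<beta>" | "y = \<beta>" | "y > \<beta>" by linarith
        then show ?case
        proof cases
          case 1
          have "g \<beta> < g y" by (rule dec) (use 1 elim a \<alpha> mid in auto)
          then show ?thesis by simp
        next
          case 3
          have "g \<beta> < g y" by (rule inc) (use 3 a \<beta> right in auto)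
          then show ?thesis by simp
        qed auto
      qed
      then show "is_pos_local_min g x" using \<open>x = \<beta>\<close> a \<beta> by (auto simp: is_pos_local_min_def)
    next
      assume "is_pos_local_min g x"
      then have x: "0 < x" "eventually (\<lambda>y. g x \<le> g y) (nhds x)" by (auto simp: is_pos_local_min_def)
      then obtain d where d: "d > 0" "\<And>y. dist y x < d \<Longrightarrow> g x \<le> g y"
        by (auto simp: eventually_nhds_metric)
      have "\<phi> x * g x = 0"
        by (rule DERIV_local_min[OF deriv[OF x(1)] d(1)]) (use d(2) in \<open>auto simp: dist_real_def abs_minus_commute\<close>)
      then have \<phi>x: "\<phi> x = 0" using pos[OF x(1)] by simp
      have "x \<noteq> \<alpha>"
      proof
        assume "x = \<alpha>"
        \<comment> \<open>Just to the right of \<alpha> the function decreases, so \<open>y\<close>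
          lies within the distance \<open>d\<close> and has a smaller value.\<close>
        define y where "y = \<alpha> + min (d / 2) (a2 - \<alpha>)"
        have y: "\<alpha> < y" "y \<le> a2" "dist y x < d"
          using d(1) \<alpha> \<open>x = \<alpha>\<close> by (auto simp: y_def dist_real_def)
        have "g y < g \<alpha>" by (rule dec) (use y a \<alpha> \<beta> mid in auto)
        then show False using d(2)[OF y(3)] \<open>x = \<alpha>\<close> by simp
      qed
      then show "x = \<beta>" using left right mid \<phi>x x(1) by (metis less_irrefl linorder_neqE_linordered_idom)
    qed
    show "g ` {\<beta><..} = {g \<beta><..}"
    proof (intro equalityI subsetI)
      fix y assume "y \<in> g ` {\<beta><..}"
      then obtain x where x: "x > \<beta>" "y = g x" by auto
      have "g \<beta> < g x" by (rule inc) (use x a \<beta> right in auto)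
      then show "y \<in> {g \<beta><..}" using x by simp
    next
      fix y assume y: "y \<in> {g \<beta><..}"
      define c where "c = \<phi> a3 * g a3"
      have c: "c > 0" using a pos[of a3] by (simp add: c_def)
      \<comment> \<open>By convexity, as \<open>a3\<close> lies between \<open>x\<close> and the
        zero \<beta>. Together with \<open>g \<ge> g a3\<close> this bounds the derivative of
        \<open>g\<close> below by \<open>c\<close>, so that \<open>g\<close> grows at least linearly
        and takes every value above \<open>g \<beta>\<close>.\<close>
      have \<phi>_ge: "\<phi> x \<ge> \<phi> a3" if "x > a3" for x
      proof -
        define t where "t = (x - a3) / (x - \<beta>)"
        have t: "0 \<le> t" "t < 1" using that \<beta> by (auto simp: t_def field_simps)
        have "t * (x - \<beta>) = x - a3" using that \<beta> by (simp add: t_def)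
        then have a3: "a3 = (1 - t) * x + t * \<beta>" by (simp add: algebra_simps)
        have "\<phi> ((1 - t) * x + t * \<beta>) \<le> (1 - t) * \<phi> x + t * \<phi> \<beta>"
          using convex_onD[OF conv, of t x \<beta>] t that a \<beta> by simp
        then have "\<phi> a3 \<le> (1 - t) * \<phi> x + t * \<phi> \<beta>" by (simp only: a3[symmetric])
        also have "\<dots> \<le> \<phi> x" using t \<beta>(3) right[of x] that \<beta>(2) by (simp add: mult_left_le_one_le)
        finally show ?thesis .
      qed
      have ge: "g x \<ge> g a3 + c * (x - a3)" if ax: "x > a3" for x
      proof -
        obtain \<xi> where \<xi>: "a3 < \<xi>" "\<xi> < x" "g x - g a3 = (x - a3) * (\<phi> \<xi> * g \<xi>)"
          using MVT2[OF ax, of g "\<lambda>x. \<phi> x * g x"] deriv a by auto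
        have "g a3 < g \<xi>" by (rule inc) (use \<xi> a \<beta> right in auto)
        then have "c \<le> \<phi> \<xi> * g \<xi>"
          unfolding c_def using \<phi>_ge[OF \<xi>(1)] a pos[of a3] by (intro mult_mono) auto
        then have "c * (x - a3) \<le> (x - a3) * (\<phi> \<xi> * g \<xi>)" using that by (simp add: mult.commute mult_left_mono)
        then show ?thesis using \<xi>(3) by simp
      qed
      define X where "X = a3 + 1 + \<bar>y\<bar> / c"
      have X: "X > a3" using c by (auto simp: X_def intro: add_pos_nonneg)
      have "c * (X - a3) = c + \<bar>y\<bar>" using c by (simp add: X_def field_simps)
      then have "c * (X - a3) \<ge> y" using c by simp
      then have gX: "y < g X" using ge[OF X] pos[of a3] a by auto
      obtain x where "\<beta> \<le> x" "x \<le> X" "g x = y"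
        using IVT'[of g \<beta> y X] y gX cg[of \<beta> X] X a \<beta> by force
      then show "y \<in> g ` {\<beta><..}" using y by (intro image_eqI[of _ _ x]) (auto simp: less_le)
    qed
  qed (use \<beta> right in auto)
qed

lemma convex_on_inverse_shift:
  assumes m: "m \<ge> 0"
  shows "convex_on {0<..} (\<lambda>x::real. 1 / (x + m))"
proof -
  have "convex_on {0<..} (\<lambda>x::real. inverse x)" by (rule convex_on_inverse) auto
  show ?thesis
  proof (rule convex_onI)
    fix t x y :: real assume *: "0 < t" "t < 1" "x \<in> {0<..}" "y \<in> {0<..}"
    have "(1 - t) *\<^sub>R x + t *\<^sub>R y + m = (1 - t) *\<^sub>R (x + m) + t *\<^sub>R (y + m)" by (simp add: algebra_simps)
    then show "1 / ((1 - t) *\<^sub>R x + t *\<^sub>R y + m) \<le> (1 - t) * (1 / (x + m)) + t * (1 / (y + m))"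
      using convex_onD[OF \<open>convex_on _ _\<close>, of t "x + m" "y + m"] * m by (simp add: inverse_eq_divide)
  qed auto
qed

section \<open>Canonical products of genus two\<close>

text \<open>A zero at the origin has two effects: \<open>g 0 = 0\<close>, so that \<open>g\<close>
  has to increase somewhere near 0, and a term \<open>r / x\<close> in the logarithmic derivative,
  which makes it strictly convex.\<close>

locale genus_two_product =
  fixes f :: "complex \<Rightarrow> complex" and r :: nat and a b :: real and l :: "nat \<Rightarrow> real"
  assumes r_pos: "r > 0" and l_pos: "\<And>k. l k > 0"
    and not_summable: "\<not> summable (\<lambda>k. 1 / l k ^ 2)" and summable: "summable (\<lambda>k. 1 / l k ^ 3)"
    and f_eq: "\<And>z. f z = z ^ r * exp (of_real a * z ^ 2 + of_real b * z) *
           (\<Prod>k. (1 + z / of_real (l k)) * exp (- z / of_real (l k) + z ^ 2 / (2 * of_real (l k) ^ 2)))"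
begin

definition A :: "nat \<Rightarrow> real" where "A n = a + (\<Sum>k<n. 1 / (2 * l k ^ 2))"

definition B :: "nat \<Rightarrow> real" where "B n = b - (\<Sum>k<n. 1 / l k)"

definition E :: "nat \<Rightarrow> complex \<Rightarrow> complex" where
  "E = (\<lambda>n (z::complex). z ^ r * exp (A n * z\<^sup>2 + B n * z) * (\<Prod>k<n. 1 + z / l k))"

lemma l_nz [simp]: "l k \<noteq> 0"
  using l_pos[of k] by simp

text \<open>The factors are Weierstrass primary factors of degree 2 with zeros \<open>- l k\<close>.
  Summability of the inverse cubes is the convergence condition for this degree and also forces
  \<open>l k\<close> to tend to infinity.\<close>

sublocale weierstrass: weierstrass_product "\<lambda>k. - of_real (l k)" "\<lambda>_. 2"
proof
  show "- complex_of_real (l n) \<noteq> 0" for n by simp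
  have "(\<lambda>k. 1 / l k ^ 3) \<longlonglongrightarrow> 0" using summable by (rule summable_LIMSEQ_zero)
  have "eventually (\<lambda>k. norm (- complex_of_real (l k)) > Z) sequentially" for Z
  proof -
    have "eventually (\<lambda>k. 1 / l k ^ 3 < 1 / (\<bar>Z\<bar> + 1) ^ 3) sequentially"
      by (rule order_tendstoD(2)[OF \<open>_ \<longlonglongrightarrow> 0\<close>]) auto
    then show ?thesis
    proof eventually_elim
      case (elim k)
      then have "(\<bar>Z\<bar> + 1) ^ 3 < l k ^ 3" using l_pos[of k] by (simp add: field_simps)
      then have "\<bar>Z\<bar> + 1 < l k" by (rule power_less_imp_less_base) (use l_pos[of k] in simp)
      then show ?case by simp
    qed
  qed
  then have "filterlim (\<lambda>k. norm (- complex_of_real (l k))) at_top sequentially"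
    unfolding filterlim_at_top_dense by blast
  then show "filterlim (\<lambda>k. - complex_of_real (l k)) at_infinity sequentially"
    by (rule filterlim_norm_at_top_imp_at_infinity)
  show "summable (\<lambda>n. (c / norm (- complex_of_real (l n))) ^ Suc 2)" for c
    using summable_mult[OF summable, of "c ^ 3"] l_pos
    by (simp add: power_divide numeral_3_eq_3 abs_of_pos mult.assoc)
qed

lemma weierstrass_factor_eq:
  fixes z :: complex
  shows "weierstrass_factor 2 (z / - of_real (l k)) =
     (1 + z / of_real (l k)) * exp (- z / of_real (l k) + z ^ 2 / (2 * of_real (l k) ^ 2))"
proof -
  have "(\<Sum>k=1..2. u ^ k / of_nat k) = u + u\<^sup>2 / 2" for u :: complex
    by (simp add: numeral_2_eq_2)
  then show ?thesis
    by (simp add: weierstrass_factor_def power_divide mult.commute)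
qed

lemma f_weierstrass:
  fixes z :: complex
  shows "f z = z ^ r * exp (a * z\<^sup>2 + b * z) * weierstrass.f z"
  unfolding f_eq weierstrass.f_def weierstrass_factor_eq ..

lemma E_weierstrass:
  fixes z :: complex
  shows "E n z = z ^ r * exp (a * z\<^sup>2 + b * z) * (\<Prod>k<n. weierstrass_factor 2 (z / - of_real (l k)))"
proof -
  have "(\<Prod>k<n. exp (- z / of_real (l k) + z ^ 2 / (2 * of_real (l k) ^ 2))) =
          exp (\<Sum>k<n. - z / of_real (l k) + z ^ 2 / (2 * of_real (l k) ^ 2))"
    by (simp add: exp_sum)
  also have "(\<Sum>k<n. - z / of_real (l k) + z ^ 2 / (2 * of_real (l k) ^ 2)) =
               (A n * z\<^sup>2 + B n * z) - (a * z\<^sup>2 + b * z)"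
    by (simp add: A_def B_def sum.distrib sum_negf sum_subtractf sum_distrib_left sum_distrib_right
        algebra_simps)
  finally show ?thesis
    unfolding weierstrass_factor_eq prod.distrib E_def by (simp add: exp_diff)
qed

lemma E_uniform_limit: "uniform_limit (ball 0 R) E f sequentially"
proof -
  define R' where "R' = \<bar>R\<bar> + 1"
  define c where "c = (\<lambda>z::complex. z ^ r * exp (a * z\<^sup>2 + b * z))"
  define Q where "Q = (\<lambda>n z. \<Prod>k<n. weierstrass_factor 2 (z / - of_real (l k)))"
  have "R' > 0" by (simp add: R'_def)
  then have "uniform_limit (cball 0 R') Q weierstrass.f sequentially"
    unfolding Q_def by (rule weierstrass.uniform_limit)
  moreover have "uniform_limit (cball 0 R') (\<lambda>_::nat. c) c sequentially"
    by (intro uniform_limit_const)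
  moreover have "bounded (c ` cball 0 R')"
    unfolding c_def by (intro compact_imp_bounded compact_continuous_image continuous_intros) auto
  moreover have "bounded (weierstrass.f ` cball 0 R')"
    by (intro compact_imp_bounded compact_continuous_image holomorphic_on_imp_continuous_on
          weierstrass.holomorphic) auto
  ultimately have "uniform_limit (cball 0 R') (\<lambda>n z. c z * Q n z) (\<lambda>z. c z * weierstrass.f z) sequentially"
    by (intro uniform_lim_mult)
  then have "uniform_limit (cball 0 R') E f sequentially"
    by (simp add: c_def Q_def E_weierstrass[abs_def] f_weierstrass[abs_def])
  then show ?thesis by (rule uniform_limit_on_subset) (auto simp: R'_def)
qed

lemma E_holomorphic: "E n holomorphic_on S"
  unfolding E_def by (intro holomorphic_intros) simp

lemma E_LIMSEQ: "(\<lambda>n. E n z) \<longlonglongrightarrow> f z"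
  using tendsto_uniform_limitI[OF E_uniform_limit[of "norm z + 1"], of z] by simp

lemma f_holomorphic: "f holomorphic_on S"
  unfolding f_weierstrass[abs_def] by (intro holomorphic_intros weierstrass.holomorphic)

lemma f_cnj: "f (cnj z) = cnj (f z)"
proof -
  have "E n (cnj z) = cnj (E n z)" for n by (simp add: E_def exp_cnj)
  then have "(\<lambda>n. E n (cnj z)) \<longlonglongrightarrow> cnj (f z)" using tendsto_cnj[OF E_LIMSEQ] by simp
  then show ?thesis using LIMSEQ_unique E_LIMSEQ by blast
qed

abbreviation g :: "real \<Rightarrow> real" where "g \<equiv> on_reals f"

lemma f_of_real: "f (of_real x) = of_real (g x)"
  using f_cnj[of "of_real x"] by (simp add: on_reals_def complex_eq_iff)

lemma g_0: "g 0 = 0"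
  using r_pos by (simp add: on_reals_def f_eq)

text \<open>The partial products give only nonnegativity in the limit. That the limit does not
  vanish is due to the convergence of the infinite product, none of whose factors is zero.\<close>

lemma g_pos:
  assumes "x > 0"
  shows "g x > 0"
proof -
  have "Re (E n (of_real x)) \<ge> 0" for n
  proof -
    have "E n (of_real x) = of_real (x ^ r * exp (A n * x\<^sup>2 + B n * x) * (\<Prod>k<n. 1 + x / l k))"
      by (simp add: E_def exp_of_real[symmetric])
    then have "Re (E n (of_real x)) = x ^ r * exp (A n * x\<^sup>2 + B n * x) * (\<Prod>k<n. 1 + x / l k)"
      by (simp only: Re_complex_of_real)
    also have "\<dots> \<ge> 0"
      using assms l_pos by (intro mult_nonneg_nonneg prod_nonneg) (auto simp: less_imp_le)
    finally show ?thesis .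
  qed
  then have "Re (f (of_real x)) \<ge> 0" by (intro LIMSEQ_le_const[OF tendsto_Re[OF E_LIMSEQ]]) auto
  moreover have "f (of_real x) \<noteq> 0"
  proof -
    have "weierstrass_factor 2 (of_real x / - of_real (l k)) \<noteq> 0" for k
      using assms l_pos[of k] by (auto simp: weierstrass_factor_eq_0_iff field_simps simp flip: of_real_add)
    then have "weierstrass.f (of_real x) \<noteq> 0"
      unfolding weierstrass.f_def by (intro prodinf_nonzero weierstrass.convergent)
    then show ?thesis using assms by (simp add: f_weierstrass)
  qed
  ultimately show ?thesis by (auto simp: f_of_real less_le)
qed

section \<open>The logarithmic derivative on the positive half line\<close>

definition \<phi> :: "real \<Rightarrow> real" where "\<phi> x = Re (deriv f (of_real x)) / g x"

lemma DERIV_g: "(g has_real_derivative Re (deriv f (of_real x))) (at x)"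
  by (intro on_reals_has_real_derivative holomorphic_derivI[OF f_holomorphic open_UNIV]) auto

lemma DERIV_g_\<phi>: "x > 0 \<Longrightarrow> (g has_real_derivative \<phi> x * g x) (at x)"
  using DERIV_g g_pos[of x] by (simp add: \<phi>_def)

lemma continuous_on_\<phi>: "continuous_on {0<..} \<phi>"
proof -
  have "continuous_on UNIV (deriv f)"
    by (intro holomorphic_on_imp_continuous_on holomorphic_deriv f_holomorphic) auto
  then have "continuous_on {0<..} (\<lambda>x. deriv f (complex_of_real x))"
    by (rule continuous_on_compose2) (auto intro: continuous_intros)
  moreover have "continuous_on {0<..} g"
    by (rule DERIV_continuous_on) (use DERIV_g in \<open>auto intro: has_field_derivative_at_within\<close>)
  ultimately show ?thesis
    unfolding \<phi>_def using g_pos by (intro continuous_intros) force+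
qed

definition \<phi>_approx :: "nat \<Rightarrow> real \<Rightarrow> real" where
  "\<phi>_approx n x = r / x + 2 * A n * x + B n + (\<Sum>k<n. 1 / (x + l k))"

lemma DERIV_E:
  assumes "x > 0"
  shows "(E n has_field_derivative of_real (\<phi>_approx n x) * E n (of_real x)) (at (of_real x))"
proof -
  have *: "((\<lambda>z::complex. 1 + z / l k) has_field_derivative 1 / (complex_of_real x + of_real (l k)) * (1 + complex_of_real x / l k)) (at (complex_of_real x))" for k
  proof -
    have "x + l k \<noteq> 0" using assms l_pos[of k] by simp
    moreover from this have "complex_of_real x + of_real (l k) \<noteq> 0"
      by (metis of_real_0 of_real_add of_real_eq_iff)
    ultimately show ?thesis by (auto intro!: derivative_eq_intros simp: field_simps)
  qed
  have P: "((\<lambda>z::complex. \<Prod>k<n. 1 + z / l k) has_field_derivative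
          (\<Sum>k<n. 1 / (complex_of_real x + of_real (l k))) * (\<Prod>k<n. 1 + complex_of_real x / l k)) (at (complex_of_real x))"
  proof (induction n)
    case (Suc n)
    have eq: "s * p * q + i * q * p = (s + i) * (p * q)" for s p q i :: complex
      by (simp add: algebra_simps)
    show ?case
      unfolding prod.lessThan_Suc sum.lessThan_Suc
      by (rule DERIV_cong[OF DERIV_mult[OF Suc *[of n]] eq])
  qed auto
  have X: "((\<lambda>z::complex. z ^ r) has_field_derivative of_nat r / of_real x * of_real x ^ r) (at (complex_of_real x))"
  proof (cases r)
    case (Suc m)
    then have "of_nat r * (1 * complex_of_real x ^ (r - Suc 0)) = of_nat r / of_real x * of_real x ^ r"
      using assms by (simp del: of_nat_Suc)
    from DERIV_cong[OF DERIV_power[OF DERIV_ident] this] show ?thesis by simp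
  qed (use r_pos in simp)
  have Y: "((\<lambda>z::complex. exp (A n * z\<^sup>2 + B n * z)) has_field_derivative
       (2 * A n * complex_of_real x + B n) * exp (A n * (complex_of_real x)\<^sup>2 + B n * complex_of_real x)) (at (complex_of_real x))"
    by (auto intro!: derivative_eq_intros)
  have eq: "(u * p * q + v * q * p) * w + s * w * (p * q) = (u + v + s) * (p * q * w)"
    for u v s p q w :: complex by (simp add: algebra_simps)
  have "of_real (\<phi>_approx n x) = of_nat r / complex_of_real x + (2 * A n * complex_of_real x + B n) +
          (\<Sum>k<n. 1 / (complex_of_real x + of_real (l k)))"
    by (simp add: \<phi>_approx_def)
  then show ?thesis
    unfolding E_def using DERIV_cong[OF DERIV_mult[OF DERIV_mult[OF X Y] P] eq] by (simp only:)
qed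

text \<open>Locally uniform convergence of holomorphic functions passes to derivatives, and division
  is possible since \<open>f\<close> has no positive zeros.\<close>

lemma \<phi>_approx_LIMSEQ:
  assumes "x > 0"
  shows "(\<lambda>n. \<phi>_approx n x) \<longlonglongrightarrow> \<phi> x"
proof -
  have "(\<lambda>n. (deriv ^^ 1) (E n) (of_real x)) \<longlonglongrightarrow> (deriv ^^ 1) f (of_real x)"
    by (rule higher_deriv_complex_uniform_limit[OF E_uniform_limit[of "\<bar>x\<bar> + 1"]])
       (use E_holomorphic in auto)
  then have "(\<lambda>n. deriv (E n) (of_real x) / E n (of_real x)) \<longlonglongrightarrow> deriv f (of_real x) / f (of_real x)"
    using g_pos[OF assms] by (intro tendsto_divide E_LIMSEQ) (auto simp: f_of_real)
  moreover have "deriv (E n) (of_real x) / E n (of_real x) = of_real (\<phi>_approx n x)" for n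
  proof -
    have "1 + complex_of_real x / of_real (l k) \<noteq> 0" for k
    proof -
      have "1 + x / l k > 0" using assms l_pos[of k] by (intro add_pos_pos) auto
      then have "complex_of_real (1 + x / l k) \<noteq> 0" by (simp only: of_real_eq_0_iff)
      then show ?thesis by simp
    qed
    then have "E n (of_real x) \<noteq> 0" using assms by (simp add: E_def)
    then show ?thesis using DERIV_imp_deriv[OF DERIV_E[OF assms]] by simp
  qed
  ultimately have "(\<lambda>n. complex_of_real (\<phi>_approx n x)) \<longlonglongrightarrow> deriv f (of_real x) / f (of_real x)" by simp
  from tendsto_Re[OF this] show ?thesis by (simp add: \<phi>_def f_of_real Re_divide_of_real)
qed

text \<open>An affine function and the fractions \<open>1 / (x + l k)\<close> remain, all convex,
  and convexity survives pointwise limits. Strict convexity would not, so \<open>r / x\<close> is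
  kept out of the limit and can contribute it afterwards.\<close>

lemma convex_on_\<phi>_minus: "convex_on {0<..} (\<lambda>x. \<phi> x - r / x)"
proof -
  have conv: "convex_on {0<..} (\<lambda>x. \<phi>_approx n x - r / x)" for n
  proof -
    have "convex_on {0<..} (\<lambda>x. 2 * A n * x + B n)"
      by (rule convex_onI) (auto simp: algebra_simps)
    moreover have "convex_on {0<..} (\<lambda>x. \<Sum>k<n. 1 / (x + l k))"
    proof (induction n)
      case (Suc n)
      from convex_on_add[OF Suc convex_on_inverse_shift[of "l n"]] show ?case
        using l_pos[of n] by (simp add: less_imp_le)
    qed (simp add: convex_on_const)
    ultimately have "convex_on {0<..} (\<lambda>x. (2 * A n * x + B n) + (\<Sum>k<n. 1 / (x + l k)))"
      by (rule convex_on_add)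
    then show ?thesis by (simp add: \<phi>_approx_def add.assoc)
  qed
  show ?thesis
  proof (rule convex_onI)
    fix t x y :: real assume *: "0 < t" "t < 1" "x \<in> {0<..}" "y \<in> {0<..}"
    then have pos: "(1 - t) * x + t * y > 0" by (intro add_pos_pos) auto
    show "\<phi> ((1 - t) *\<^sub>R x + t *\<^sub>R y) - r / ((1 - t) *\<^sub>R x + t *\<^sub>R y)
        \<le> (1 - t) * (\<phi> x - r / x) + t * (\<phi> y - r / y)"
    proof (rule LIMSEQ_le)
      show "(\<lambda>n. \<phi>_approx n ((1 - t) *\<^sub>R x + t *\<^sub>R y) - r / ((1 - t) *\<^sub>R x + t *\<^sub>R y))
           \<longlonglongrightarrow> \<phi> ((1 - t) *\<^sub>R x + t *\<^sub>R y) - r / ((1 - t) *\<^sub>R x + t *\<^sub>R y)"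
        using pos by (intro tendsto_intros \<phi>_approx_LIMSEQ) simp
      show "(\<lambda>n. (1 - t) * (\<phi>_approx n x - r / x) + t * (\<phi>_approx n y - r / y))
           \<longlonglongrightarrow> (1 - t) * (\<phi> x - r / x) + t * (\<phi> y - r / y)"
        using * by (intro tendsto_intros \<phi>_approx_LIMSEQ) auto
      show "\<exists>N. \<forall>n\<ge>N. \<phi>_approx n ((1 - t) *\<^sub>R x + t *\<^sub>R y) - r / ((1 - t) *\<^sub>R x + t *\<^sub>R y)
           \<le> (1 - t) * (\<phi>_approx n x - r / x) + t * (\<phi>_approx n y - r / y)"
        using convex_onD[OF conv, of t x y] * by auto
    qed
  qed auto
qed

lemma convex_on_\<phi>: "convex_on {0<..} \<phi>"
proof -
  have "convex_on {0<..} (\<lambda>x::real. r * (1 / (x + 0)))"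
    by (intro convex_on_cmul convex_on_inverse_shift) auto
  from convex_on_add[OF convex_on_\<phi>_minus this] show ?thesis by simp
qed

lemma \<phi>_strictly_convex_midpoint:
  assumes "0 < x" "x < y"
  shows "\<phi> ((x + y) / 2) < (\<phi> x + \<phi> y) / 2"
proof -
  have mid: "(1 - 1 / 2) *\<^sub>R x + (1 / 2) *\<^sub>R y = (x + y) / 2" by (simp add: field_simps)
  have conv: "\<phi> ((x + y) / 2) - r / ((x + y) / 2) \<le> (1 - 1 / 2) * (\<phi> x - r / x) + (1 / 2) * (\<phi> y - r / y)"
    using convex_onD[OF convex_on_\<phi>_minus, of "1 / 2" x y] assms unfolding mid by simp
  have "1 / ((x + y) / 2) < (1 / x + 1 / y) / 2"
  proof -
    have "(1 / x + 1 / y) / 2 - 1 / ((x + y) / 2) = (x - y)\<^sup>2 / (2 * x * y * (x + y))"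
      using assms by (simp add: field_simps power2_eq_square)
    also have "\<dots> > 0" using assms by (intro divide_pos_pos mult_pos_pos) auto
    finally show ?thesis by simp
  qed
  then have "r * (1 / ((x + y) / 2)) < r * ((1 / x + 1 / y) / 2)"
    using r_pos by (intro mult_strict_left_mono) auto
  then have "r / ((x + y) / 2) < (r / x + r / y) / 2" by (simp add: field_simps)
  moreover have "p - q \<le> (1 - 1 / 2) * (s - u) + (1 / 2) * (t - v) \<Longrightarrow> q < (u + v) / 2 \<Longrightarrow> p < (s + t) / 2"
    for p q s t u v :: real by (simp add: field_simps)
  ultimately show ?thesis using conv by blast
qed

lemma f_has_sections:
  assumes "x > 0" "\<phi> x < 0"
  shows "has_sections f"
proof (rule has_sections_limit[OF _ E_uniform_limit])
  \<comment> \<open>\<open>A n > 0\<close> says exactly that the sum of the first \<open>n\<close>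
    inverse squares exceeds \<open>- 2 * a\<close>.\<close>
  have "\<exists>N. (\<Sum>k<N. 1 / l k ^ 2) > - 2 * a"
  proof (rule ccontr)
    assume "\<nexists>N. (\<Sum>k<N. 1 / l k ^ 2) > - 2 * a"
    then have "summable (\<lambda>k. 1 / l k ^ 2)"
      by (intro summableI_nonneg_bounded[of _ "- 2 * a"]) (auto simp: not_less)
    then show False using not_summable by simp
  qed
  then obtain N where N: "(\<Sum>k<N. 1 / l k ^ 2) > - 2 * a" by blast
  have "(\<Sum>k<N. 1 / l k ^ 2) \<le> (\<Sum>k<n. 1 / l k ^ 2)" if "n \<ge> N" for n
    using that by (intro sum_mono2) auto
  then have "eventually (\<lambda>n. (\<Sum>k<n. 1 / l k ^ 2) > - 2 * a) sequentially"
    using N by (intro eventually_sequentiallyI[of N]) (auto intro: less_le_trans)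
  moreover have "eventually (\<lambda>n. \<phi>_approx n x < 0) sequentially"
    using order_tendstoD(2)[OF \<phi>_approx_LIMSEQ] assms by blast
  ultimately show "eventually (\<lambda>n. has_sections (E n)) sequentially"
  proof eventually_elim
    case (elim n)
    have "A n = a + (\<Sum>k<n. 1 / l k ^ 2) / 2" by (simp add: A_def sum_divide_distrib mult.commute)
    then have "A n > 0" using elim by simp
    then show ?case
      unfolding E_def using exp_poly_has_sections[of "A n" n l x r "B n"] l_pos assms elim
      by (simp add: \<phi>_approx_def)
  qed
qed (use f_holomorphic holomorphic_on_imp_continuous_on in blast)

text \<open>With \<open>g 0 = 0\<close> the mean value theorem turns three values of
  \<open>g\<close> into the sign pattern of \<phi>. The inequality \<open>g x2 \<le> g x1\<close> is
  not strict because \<open>G 1 = G 2\<close>.\<close>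

theorem inverse_extends:
  assumes x: "0 < x1" "x1 < x2" "x2 < x3" and gx: "g x2 \<le> g x1" "g x2 < g x3"
  defines "\<beta> \<equiv> pos_local_min_point g"
  shows "\<exists>c d. 0 \<le> c \<and> c < d \<and> strict_antimono_on {c<..<d} g"
    and "\<exists>!x. is_pos_local_min g x"
    and "strict_mono_on {\<beta><..} g"
    and "bij_betw g {\<beta><..} {g \<beta><..}"
    and "bij_betw (the_inv_into {\<beta><..} g) {g \<beta><..} {\<beta><..}"
    and "extends_to_univalent_Pick_function (the_inv_into {\<beta><..} g) {g \<beta><..}"
proof -
  have contg: "continuous_on S g" for S
    by (rule DERIV_continuous_on) (use DERIV_g in \<open>auto intro: has_field_derivative_at_within\<close>)
  have mvt: "\<exists>\<xi>. u < \<xi> \<and> \<xi> < v \<and> g v - g u = (v - u) * (\<phi> \<xi> * g \<xi>)" if "0 \<le> u" "u < v" for u v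
  proof -
    obtain \<xi> where \<xi>: "u < \<xi>" "\<xi> < v" "g v - g u = (v - u) * Re (deriv f (of_real \<xi>))"
      using MVT2[OF \<open>u < v\<close>, of g "\<lambda>x. Re (deriv f (of_real x))"] DERIV_g by blast
    moreover have "\<phi> \<xi> * g \<xi> = Re (deriv f (of_real \<xi>))"
      using g_pos[of \<xi>] \<xi> \<open>0 \<le> u\<close> by (simp add: \<phi>_def)
    ultimately show ?thesis by auto
  qed
  have pos: "\<exists>\<xi>. u < \<xi> \<and> \<xi> < v \<and> \<phi> \<xi> > 0" if uv: "0 \<le> u" "u < v" "g u < g v" for u v
  proof -
    obtain \<xi> where \<xi>: "u < \<xi>" "\<xi> < v" "g v - g u = (v - u) * (\<phi> \<xi> * g \<xi>)"
      using mvt[OF uv(1,2)] by blast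
    then have "(v - u) * (\<phi> \<xi> * g \<xi>) > 0" using uv(3) by linarith
    then have "\<phi> \<xi> * g \<xi> > 0" using uv(2) by (simp add: zero_less_mult_iff)
    then have "\<phi> \<xi> > 0" using g_pos[of \<xi>] \<xi>(1) uv(1) by (simp add: zero_less_mult_iff)
    then show ?thesis using \<xi> by blast
  qed
  obtain a1 where a1: "0 < a1" "a1 < x1" "\<phi> a1 > 0" using pos[of 0 x1] g_0 g_pos x by auto
  obtain a3 where a3: "x2 < a3" "a3 < x3" "\<phi> a3 > 0" using pos[of x2 x3] gx x by auto
  obtain a2 where a2: "x1 < a2" "a2 < x2" "\<phi> a2 < 0"
  proof -
    \<comment> \<open>The midpoint is for the case \<open>g x1 = g x2\<close>. If \<phi> is
      nonnegative at both \<open>u\<close> and \<open>v\<close>, the two increments are nonnegative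
      with a nonpositive sum, so \<phi> vanishes at \<open>u\<close> and \<open>v\<close> and strict
      convexity makes it negative halfway.\<close>
    define m where "m = (x1 + x2) / 2"
    have m: "x1 < m" "m < x2" using x by (auto simp: m_def)
    obtain u where u: "x1 < u" "u < m" "g m - g x1 = (m - x1) * (\<phi> u * g u)" using mvt[of x1 m] m x by auto
    obtain v where v: "m < v" "v < x2" "g x2 - g m = (x2 - m) * (\<phi> v * g v)" using mvt[of m x2] m x by auto
    show ?thesis
    proof (cases "\<phi> u < 0 \<or> \<phi> v < 0")
      case True
      then show ?thesis using that u v m by (meson less_trans)
    next
      case False
      have gu: "g u > 0" "g v > 0" using g_pos u v m x by auto
      have "g m - g x1 \<ge> 0" "g x2 - g m \<ge> 0" using u v m gu False by (auto simp: not_less)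
      then have "g m - g x1 = 0" "g x2 - g m = 0" using gx by auto
      then have "\<phi> u = 0" "\<phi> v = 0" using u v m gu by auto
      then have "\<phi> ((u + v) / 2) < 0" using \<phi>_strictly_convex_midpoint[of u v] u v m x by auto
      then show ?thesis using that[of "(u + v) / 2"] u v m by auto
    qed
  qed
  have a12: "a1 < a2" and a23: "a2 < a3" using a1 a2 a3 by auto
  obtain \<beta>' where \<beta>': "a2 < \<beta>'" "\<And>x. x > \<beta>' \<Longrightarrow> \<phi> x > 0" "strict_antimono_on {a2<..<\<beta>'} g"
    "\<And>x. is_pos_local_min g x \<longleftrightarrow> x = \<beta>'" "g ` {\<beta>'<..} = {g \<beta>'<..}"
    by (rule convex_log_derivative_shape[OF g_pos DERIV_g_\<phi> continuous_on_\<phi> convex_on_\<phi>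
          a1(1) a12 a23 a1(3) a2(3) a3(3)]) (assumption | rule that)+
  have \<beta>_eq: "\<beta> = \<beta>'" unfolding \<beta>_def pos_local_min_point_def \<beta>'(4) by simp
  note \<beta> = \<beta>'[folded \<beta>_eq]
  have \<beta>_pos: "\<beta> > 0" using \<beta>(1) a2 x by simp
  show "\<exists>c d. 0 \<le> c \<and> c < d \<and> strict_antimono_on {c<..<d} g"
    using \<beta>(1,3) a2 x by (intro exI[of _ a2] exI[of _ \<beta>]) auto
  show "\<exists>!x. is_pos_local_min g x" by (simp add: \<beta>(4))
  have der: "Re (deriv f (of_real x)) > 0" if "x > \<beta>" for x
    using \<beta>(2)[OF that] g_pos[of x] that \<beta>_pos by (simp add: \<phi>_def zero_less_divide_iff)
  have sec: "has_sections f" by (rule f_has_sections[of a2]) (use a2 x in auto)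
  show mono: "strict_mono_on {\<beta><..} g"
  proof (rule strict_mono_onI)
    fix u v assume uv: "u \<in> {\<beta><..}" "v \<in> {\<beta><..}" "u < v"
    show "g u < g v"
    proof (rule DERIV_pos_imp_increasing[OF uv(3)])
      show "\<exists>y. (g has_real_derivative y) (at x) \<and> 0 < y" if "u \<le> x" "x \<le> v" for x
        using DERIV_g[of x] der[of x] that uv by auto
    qed
  qed
  show bij: "bij_betw g {\<beta><..} {g \<beta><..}"
    unfolding bij_betw_def using strict_mono_on_imp_inj_on[OF mono] \<beta>(5) by blast
  show "bij_betw (the_inv_into {\<beta><..} g) {g \<beta><..} {\<beta><..}"
    by (rule bij_betw_the_inv_into[OF bij])
  show "extends_to_univalent_Pick_function (the_inv_into {\<beta><..} g) {g \<beta><..}"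
    using has_sections_extends_to_univalent_Pick_function[where \<beta> = \<beta>, OF f_holomorphic f_cnj sec der]
    by (simp only: \<beta>(5))
qed

end

section \<open>Barnes' products\<close>

text \<open>
  \<open>block_index\<close> is the sequence \<open>1, 1, 2, 2, 2, 3, 3, 3, 3, \<dots>\<close> of the zeros of \<open>z \<mapsto> G (- z)\<close>
  other than \<open>0\<close>, where \<open>k\<close> occurs \<open>k + 1\<close> times.
\<close>
definition block_end :: "nat \<Rightarrow> nat" where "block_end n = (\<Sum>k<n. k + 2)"

text \<open>\<open>block_end n\<close> counts the entries with value at most \<open>n\<close>, so
  the entry with index \<open>i\<close> is the least \<open>j\<close> that has more than
  \<open>i\<close> entries up to it.\<close>

definition block_index :: "nat \<Rightarrow> nat" where "block_index i = (LEAST j. i < block_end j)"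

lemma block_end_0 [simp]: "block_end 0 = 0"
  and block_end_Suc [simp]: "block_end (Suc n) = block_end n + (n + 2)"
  by (simp_all add: block_end_def)

lemma block_end_ge: "n \<le> block_end n"
  by (induction n) auto

lemma strict_mono_block_end: "strict_mono block_end"
  by (rule strict_mono_Suc_iff[THEN iffD2]) simp

lemma less_block_end_index: "i < block_end (block_index i)"
  unfolding block_index_def
proof (rule LeastI)
  show "i < block_end (Suc i)" using block_end_ge[of "Suc i"] by simp
qed

lemma block_index_eq:
  assumes "block_end n \<le> i" "i < block_end (Suc n)"
  shows "block_index i = Suc n"
  unfolding block_index_def
proof (rule Least_equality)
  show "i < block_end (Suc n)" by (fact assms(2))
  fix j assume "i < block_end j"
  then have "block_end n < block_end j" using assms by simp
  then show "Suc n \<le> j" using strict_mono_less[OF strict_mono_block_end] by simp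
qed

lemma block_index_pos: "0 < block_index i"
  using less_block_end_index[of i] by (cases "block_index i") auto

lemma incseq_block_index: "incseq block_index"
proof (rule incseq_SucI)
  fix i show "block_index i \<le> block_index (Suc i)"
    unfolding block_index_def[of i] by (rule Least_le) (use less_block_end_index[of "Suc i"] in simp)
qed

lemma lessThan_block_end_Suc:
  "{..<block_end (Suc n)} = {..<block_end n} \<union> {block_end n..<block_end (Suc n)}"
  by auto

lemma sum_block_index:
  fixes F :: "nat \<Rightarrow> 'a::{semiring_1}"
  shows "(\<Sum>i<block_end n. F (block_index i)) = (\<Sum>k<n. of_nat (k + 2) * F (Suc k))"
proof (induction n)
  case (Suc n)
  have "(\<Sum>i=block_end n..<block_end (Suc n). F (block_index i)) =
          (\<Sum>i=block_end n..<block_end (Suc n). F (Suc n))"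
    by (intro sum.cong) (auto simp del: block_end_Suc simp: block_index_eq)
  then show ?case
    unfolding lessThan_block_end_Suc by (subst sum.union_disjoint) (auto simp: Suc)
qed auto

lemma prod_block_index:
  fixes F :: "nat \<Rightarrow> 'a::{comm_monoid_mult}"
  shows "(\<Prod>i<block_end n. F (block_index i)) = (\<Prod>k<n. F (Suc k) ^ (k + 2))"
proof (induction n)
  case (Suc n)
  have "(\<Prod>i=block_end n..<block_end (Suc n). F (block_index i)) =
          (\<Prod>i=block_end n..<block_end (Suc n). F (Suc n))"
    by (intro prod.cong) (auto simp del: block_end_Suc simp: block_index_eq)
  then show ?case
    unfolding lessThan_block_end_Suc by (subst prod.union_disjoint) (auto simp: Suc)
qed auto

text \<open>Grouped by value, the terms are \<open>(k + 1) / k^3 \<le> 2 / k^2\<close>.\<close>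

lemma summable_block_index_cubes: "summable (\<lambda>i. 1 / real (block_index i) ^ 3)"
proof (rule summableI_nonneg_bounded)
  fix n
  have "(\<Sum>i<n. 1 / real (block_index i) ^ 3) \<le> (\<Sum>i<block_end n. 1 / real (block_index i) ^ 3)"
    using block_end_ge[of n] by (intro sum_mono2) auto
  also have "\<dots> = (\<Sum>k<n. real (k + 2) * (1 / real (Suc k) ^ 3))"
    by (rule sum_block_index)
  also have "\<dots> \<le> (\<Sum>k<n. 2 * (1 / real (k + 1) ^ 2))"
  proof (rule sum_mono)
    fix k
    have "real (k + 2) * (1 / real (Suc k) ^ 3) \<le> (2 * real (Suc k)) * (1 / real (Suc k) ^ 3)"
      by (intro mult_right_mono) auto
    also have "\<dots> = 2 * (1 / real (k + 1) ^ 2)"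
    proof -
      have "2 * m * (1 / m ^ 3) = 2 * (1 / m\<^sup>2)" if "m > 0" for m :: real
        using that by (simp add: power3_eq_cube power2_eq_square)
      from this[of "real (Suc k)"] show ?thesis by simp
    qed
    finally show "real (k + 2) * (1 / real (Suc k) ^ 3) \<le> 2 * (1 / real (k + 1) ^ 2)" .
  qed
  also have "\<dots> \<le> (\<Sum>k. 2 * (1 / real (k + 1) ^ 2))"
    using inverse_squares_sums by (intro sum_le_suminf summable_mult) (auto simp: sums_iff)
  finally show "(\<Sum>i<n. 1 / real (block_index i) ^ 3) \<le> (\<Sum>k. 2 * (1 / real (k + 1) ^ 2))" .
qed auto

text \<open>Grouped by value, the terms are \<open>(k + 1) / k^2 \<ge> 1 / k\<close>.\<close>

lemma not_summable_block_index_squares: "\<not> summable (\<lambda>i. 1 / real (block_index i) ^ 2)"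
proof
  assume s: "summable (\<lambda>i. 1 / real (block_index i) ^ 2)"
  have "summable (\<lambda>k. 1 / real (Suc k))"
  proof (rule summableI_nonneg_bounded)
    fix n
    have "(\<Sum>k<n. 1 / real (Suc k)) \<le> (\<Sum>k<n. real (k + 2) * (1 / real (Suc k) ^ 2))"
    proof (rule sum_mono)
      fix k
      have "1 / real (Suc k) = real (Suc k) * (1 / real (Suc k) ^ 2)" by (simp add: power2_eq_square)
      also have "\<dots> \<le> real (k + 2) * (1 / real (Suc k) ^ 2)" by (intro mult_right_mono) auto
      finally show "1 / real (Suc k) \<le> real (k + 2) * (1 / real (Suc k) ^ 2)" .
    qed
    also have "\<dots> = (\<Sum>i<block_end n. 1 / real (block_index i) ^ 2)"
      by (rule sum_block_index[symmetric])
    also have "\<dots> \<le> (\<Sum>i. 1 / real (block_index i) ^ 2)"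
      by (intro sum_le_suminf s) auto
    finally show "(\<Sum>k<n. 1 / real (Suc k)) \<le> (\<Sum>i. 1 / real (block_index i) ^ 2)" .
  qed auto
  then show False
    using not_summable_harmonic[where 'a = real] summable_Suc_iff[of "\<lambda>k. 1 / real k"] by (simp add: inverse_eq_divide)
qed

text \<open>If \<open>D n\<close> tends to \<open>d\<close>, then \<open>D n ^ 2 / D (2 * n)\<close>
  tends to \<open>d\<close> as well. The powers of \<open>n\<close> and \<open>exp\<close> cancel in
  the square of this quotient, leaving Wallis' product \<open>W n\<close> times
  \<open>4 + 2 / n\<close>, with limit \<open>2 * pi\<close>.\<close>

lemma stirling_constant:
  assumes lim: "(\<lambda>n. fact n * exp (real n) / (real n ^ n * sqrt (real n))) \<longlonglongrightarrow> d" and "d \<noteq> 0"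
  shows "d = sqrt (2 * pi)"
proof -
  define D where "D = (\<lambda>n. fact n * exp (real n) / (real n ^ n * sqrt (real n)))"
  define W where "W = (\<lambda>n. \<Prod>k=1..n. (4*real k^2) / (4*real k^2 - 1))"
  have W: "W n = 2 ^ (4 * n) * fact n ^ 4 / (fact (2 * n) ^ 2 * (2 * real n + 1))" for n
  proof (induction n)
    case (Suc n)
    define x where "x = real n"
    have x: "x \<ge> 0" by (simp add: x_def)
    have f: "fact (2 * Suc n) = (2 * x + 2) * ((2 * x + 1) * fact (2 * n))"
      "fact (Suc n) = (x + 1) * fact n" "real (Suc n) = x + 1"
      by (simp_all add: x_def algebra_simps)
    have "W (Suc n) = W n * (4 * (x + 1)\<^sup>2 / (4 * (x + 1)\<^sup>2 - 1))"
      by (simp add: W_def x_def add.commute)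
    also have "4 * (x + 1)\<^sup>2 - 1 = (2 * x + 1) * (2 * x + 3)"
      by (simp add: power2_eq_square algebra_simps)
    also have "W n * (4 * (x + 1)\<^sup>2 / ((2 * x + 1) * (2 * x + 3))) =
       2 ^ (4 * Suc n) * fact (Suc n) ^ 4 / (fact (2 * Suc n) ^ 2 * (2 * real (Suc n) + 1))"
    proof -
      have eq: "p * q ^ 4 / (e\<^sup>2 * u) * (4 * v\<^sup>2 / (u * w)) =
              16 * p * (v * q) ^ 4 / ((2 * v * (u * e))\<^sup>2 * w)"
        if "v \<noteq> 0" for p q e u v w :: real
        using that by (simp add: power_mult_distrib power2_eq_square power4_eq_xxxx field_simps)
      have "2 ^ (4 * Suc n) = (16 :: real) * 2 ^ (4 * n)" "2 * (x + 1) + 1 = 2 * x + 3"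
        "2 * x + 2 = 2 * (x + 1)" by (simp_all add: power_add)
      then show ?thesis
        using eq[of "x + 1" "2 ^ (4 * n)" "fact n" "fact (2 * n)" "2 * x + 1" "2 * x + 3"] x
        by (simp only: Suc.IH f x_def[symmetric])
    qed
    finally show ?case .
  qed (simp add: W_def)
  have dbl: "strict_mono (\<lambda>n::nat. 2 * n)" by (simp add: strict_mono_def)
  have "(\<lambda>n. (D n ^ 2 / D (2 * n)) ^ 2) \<longlonglongrightarrow> (d ^ 2 / d) ^ 2"
    using lim LIMSEQ_subseq_LIMSEQ[OF lim dbl] \<open>d \<noteq> 0\<close>
    by (intro tendsto_intros) (auto simp: D_def o_def)
  moreover have "eventually (\<lambda>n. (D n ^ 2 / D (2 * n)) ^ 2 = W n * (4 + 2 / real n)) sequentially"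
    using eventually_gt_at_top[of 0]
  proof eventually_elim
    case (elim n)
    define x where "x = real n"
    have x: "x > 0" using elim by (simp add: x_def)
    have "exp (real (2 * n)) = exp x ^ 2" "real (2 * n) ^ (2 * n) = 2 ^ (2 * n) * (x ^ n) ^ 2"
      by (simp_all add: x_def exp_of_nat_mult[symmetric] power_mult_distrib power_mult[symmetric] mult.commute flip: exp_double)
    then have "D (2 * n) ^ 2 = fact (2 * n) ^ 2 * exp x ^ 4 / (2 ^ (4 * n) * (x ^ n) ^ 4 * (2 * x))"
      using x by (simp add: D_def power_divide power_mult_distrib x_def[symmetric] power_mult[symmetric] mult.assoc)
    moreover have "(D n ^ 2) ^ 2 = fact n ^ 4 * exp x ^ 4 / ((x ^ n) ^ 4 * x\<^sup>2)"
    proof -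
      have "sqrt x ^ 4 = x\<^sup>2" using x by (simp add: power4_eq_xxxx power2_eq_square)
      then show ?thesis
        by (simp add: D_def power_divide power_mult_distrib x_def[symmetric] power_mult[symmetric] mult.commute)
    qed
    moreover have "(p * e / (y * x\<^sup>2)) / (q * e / (t * y * (2 * x))) = t * p / (q * (2 * x + 1)) * (4 + 2 / x)"
      if "e \<noteq> 0" "y \<noteq> 0" for p q e y t :: real
    proof -
      have "4 + 2 / x = 2 * (2 * x + 1) / x" using x by (simp add: field_simps)
      moreover have "2 * x + 1 \<noteq> 0" using x by simp
      moreover have "(p * e / (y * x\<^sup>2)) / (q * e / (t * y * (2 * x))) = t * p / (q * u) * (2 * u / x)"
        if "u \<noteq> 0" for u
        using that \<open>e \<noteq> 0\<close> \<open>y \<noteq> 0\<close> x by (simp add: power2_eq_square mult_ac)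
      ultimately show ?thesis by metis
    qed
    moreover have "exp x ^ 4 \<noteq> 0" "(x ^ n) ^ 4 \<noteq> 0" using x by auto
    ultimately have "(D n ^ 2) ^ 2 / D (2 * n) ^ 2 =
        2 ^ (4 * n) * fact n ^ 4 / (fact (2 * n) ^ 2 * (2 * x + 1)) * (4 + 2 / x)"
      by metis
    then show ?case unfolding W x_def[symmetric] power_divide[of "(D n)\<^sup>2"] .
  qed
  ultimately have "(\<lambda>n. W n * (4 + 2 / real n)) \<longlonglongrightarrow> (d ^ 2 / d) ^ 2"
    by (rule Lim_transform_eventually)
  moreover have "(\<lambda>n. W n * (4 + 2 / real n)) \<longlonglongrightarrow> pi / 2 * (4 + 0)"
    using wallis unfolding W_def by (intro tendsto_intros lim_const_over_n)
  ultimately have "(d ^ 2 / d) ^ 2 = pi / 2 * (4 + 0)" by (rule LIMSEQ_unique)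
  then have "d ^ 2 = 2 * pi" using \<open>d \<noteq> 0\<close> by (simp add: power2_eq_square)
  moreover have "d \<ge> 0" by (rule LIMSEQ_le_const[OF lim]) auto
  ultimately show ?thesis by (metis real_sqrt_unique)
qed

text \<open>With \<open>t = m * |w - 1|\<close> the difference is at most
  \<open>exp t - 1 \<le> t + t^2\<close>. This handles the growing exponents in Barnes'
  product.\<close>

lemma norm_power_minus_one_le:
  fixes w :: complex
  assumes "real m * norm (w - 1) \<le> 1"
  shows "norm (w ^ m - 1) \<le> 2 * (real m * norm (w - 1))"
proof -
  define t where "t = real m * norm (w - 1)"
  have t: "0 \<le> t" "t \<le> 1" using assms by (auto simp: t_def)
  have "norm ((\<Prod>k<m. 1 + (w - 1)) - 1) \<le> (\<Prod>k<m. 1 + norm (w - 1)) - 1"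
    by (rule norm_prod_minus1_le_prod_minus1)
  then have "norm (w ^ m - 1) \<le> (1 + norm (w - 1)) ^ m - 1" by simp
  also have "(1 + norm (w - 1)) ^ m \<le> exp (norm (w - 1)) ^ m"
    by (intro power_mono exp_ge_add_one_self) auto
  also have "\<dots> = exp t" by (simp add: t_def exp_of_nat_mult)
  also have "\<dots> \<le> 1 + t + t\<^sup>2" using t by (intro exp_bound) auto
  also have "t\<^sup>2 \<le> t" using t by (simp add: power2_eq_square mult_left_le)
  finally show ?thesis by (simp add: t_def)
qed

text \<open>With \<open>m = Suc k\<close>, the factor is the \<open>m\<close>-th power of the
  primary factor of degree 2 at \<open>- z / m\<close>, which differs from 1 by at most
  \<open>3 * |z / m|^3\<close>. The power therefore costs one order and leaves a bound of order
  \<open>1 / m^2\<close>.\<close>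

lemma convergent_prod_barnes:
  fixes z :: complex
  shows "convergent_prod (\<lambda>k. (1 + z / of_nat (Suc k)) ^ Suc k * exp (- z + z ^ 2 / (2 * of_nat (Suc k))))"
proof -
  define w where "w = (\<lambda>k. weierstrass_factor 2 (- z / of_nat (Suc k)))"
  have eq: "(1 + z / of_nat (Suc k)) ^ Suc k * exp (- z + z ^ 2 / (2 * of_nat (Suc k))) = w k ^ Suc k" for k
  proof -
    have "(\<Sum>j=1..2. u ^ j / of_nat j) = u + u\<^sup>2 / 2" for u :: complex
      by (simp add: numeral_2_eq_2)
    then have "w k ^ Suc k = (1 + z / of_nat (Suc k)) ^ Suc k *
        exp (of_nat (Suc k) * (- z / of_nat (Suc k) + (- z / of_nat (Suc k))\<^sup>2 / 2))"
      unfolding w_def weierstrass_factor_def by (simp only: power_mult_distrib exp_of_nat_mult) simp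
    also have "m * (- z / m + (- z / m)\<^sup>2 / 2) = - z + z ^ 2 / (2 * m)" if "m \<noteq> 0" for m
      using that by (simp add: field_simps power2_eq_square)
    from this[of "of_nat (Suc k)"]
    have "of_nat (Suc k) * (- z / of_nat (Suc k) + (- z / of_nat (Suc k))\<^sup>2 / 2) = - z + z ^ 2 / (2 * of_nat (Suc k))"
      by (simp del: of_nat_Suc)
    finally show ?thesis ..
  qed
  have "summable (\<lambda>k. norm (w k ^ Suc k - 1))"
  proof (rule summable_comparison_test_ev)
    define c where "c = 3 * norm z ^ 3"
    have lim: "(\<lambda>k. t * inverse (real (Suc k))) \<longlonglongrightarrow> 0" for t
      using tendsto_mult_right_zero[OF LIMSEQ_inverse_real_of_nat, of t] by simp
    have "eventually (\<lambda>k. norm z * inverse (real (Suc k)) < 1 / 2) sequentially"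
      by (rule order_tendstoD(2)[OF lim]) simp
    moreover have "eventually (\<lambda>k. c * inverse (real (Suc k)) < 1) sequentially"
      by (rule order_tendstoD(2)[OF lim]) simp
    ultimately show "eventually (\<lambda>k. norm (norm (w k ^ Suc k - 1)) \<le> 2 * c * (1 / real (k + 1) ^ 2)) sequentially"
    proof eventually_elim
      case (elim k)
      define m where "m = real (Suc k)"
      have m: "m \<ge> 1" by (simp add: m_def)
      have "norm (- z / of_nat (Suc k)) = norm z / m" by (simp add: norm_divide m_def del: of_nat_Suc)
      moreover have "norm z / m < 1 / 2" using elim(1) unfolding m_def by (simp only: divide_inverse)
      ultimately have "norm (w k - 1) \<le> 3 * (norm z / m) ^ Suc 2"
        using weierstrass_factor_bound[of "- z / of_nat (Suc k)" 2] unfolding w_def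
        by (simp only: less_imp_le)
      then have "m * norm (w k - 1) \<le> m * (3 * (norm z / m) ^ Suc 2)"
        using m by (intro mult_left_mono) auto
      also have "\<dots> = c / m\<^sup>2" using m by (simp add: c_def field_simps power2_eq_square numeral_2_eq_2 power3_eq_cube)
      finally have le: "m * norm (w k - 1) \<le> c / m\<^sup>2" .
      have "c / m\<^sup>2 \<le> c / m" using m by (intro divide_left_mono) (auto simp: c_def power2_eq_square)
      also have "\<dots> < 1" using elim(2) unfolding m_def by (simp only: divide_inverse)
      finally have "m * norm (w k - 1) \<le> 1" using le by linarith
      then have "norm (w k ^ Suc k - 1) \<le> 2 * (m * norm (w k - 1))"
        unfolding m_def by (rule norm_power_minus_one_le)
      also have "\<dots> \<le> 2 * (c / m\<^sup>2)" using le by simp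
      finally show ?case by (simp add: m_def add.commute)
    qed
    show "summable (\<lambda>k. 2 * c * (1 / real (k + 1) ^ 2))"
      using inverse_squares_sums by (intro summable_mult) (auto simp: sums_iff)
  qed
  then have "abs_convergent_prod (\<lambda>k. w k ^ Suc k)" by (simp add: abs_convergent_prod_conv_summable)
  then show ?thesis unfolding eq by (rule abs_convergent_prod_imp_convergent_prod)
qed

text \<open>The argument is the one of the classical formula for \<open>G (z + 1)\<close>, hence the
  limit of \<open>barnes_partial n z\<close> is \<open>barnes_G (z + 1)\<close>.\<close>

definition barnes_partial :: "nat \<Rightarrow> complex \<Rightarrow> complex" where
  "barnes_partial n z = of_real (2 * pi) powr (z / 2) *
     exp (- ((1 + of_real euler_mascheroni) * z ^ 2 + z) / 2) *
     (\<Prod>k<n. (1 + z / of_nat (Suc k)) ^ Suc k * exp (- z + z ^ 2 / (2 * of_nat (Suc k))))"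

lemma barnes_partial_LIMSEQ: "(\<lambda>n. barnes_partial n (s - 1)) \<longlonglongrightarrow> barnes_G s"
proof -
  have "(\<lambda>n. barnes_partial (Suc n) (s - 1)) \<longlonglongrightarrow> barnes_G s"
    unfolding barnes_partial_def barnes_G_def Let_def lessThan_Suc_atMost
    by (intro tendsto_mult tendsto_const convergent_prod_LIMSEQ convergent_prod_barnes)
  then show ?thesis by (rule LIMSEQ_imp_Suc)
qed

section \<open>Comparison of Barnes' product with a canonical product\<close>

definition harm_c :: "nat \<Rightarrow> complex" where "harm_c n = (\<Sum>k<n. 1 / of_nat (Suc k))"

definition squares_c :: "nat \<Rightarrow> complex" where "squares_c n = (\<Sum>k<n. 1 / of_nat (Suc k) ^ 2)"

lemma harm_c_Suc: "harm_c (Suc n) = harm_c n + 1 / of_nat (Suc n)"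
  by (simp add: harm_c_def)

lemma harm_c_LIMSEQ: "(\<lambda>n. harm_c n - of_real (ln (real n)) - of_real euler_mascheroni) \<longlonglongrightarrow> 0"
proof -
  have "harm_c n = of_real (harm n)" for n
    by (induction n) (simp_all add: harm_c_def harm_Suc harm_expand inverse_eq_divide)
  moreover have "(\<lambda>n. complex_of_real ((harm n - ln (real n)) - euler_mascheroni)) \<longlonglongrightarrow>
                   of_real (euler_mascheroni - euler_mascheroni)"
    by (intro tendsto_of_real tendsto_diff tendsto_const euler_mascheroni_LIMSEQ)
  ultimately show ?thesis by simp
qed

lemma squares_c_LIMSEQ: "squares_c \<longlonglongrightarrow> of_real (pi\<^sup>2 / 6)"
proof -
  have "(\<lambda>n. complex_of_real (\<Sum>k<n. 1 / (real k + 1)\<^sup>2)) \<longlonglongrightarrow> of_real (pi\<^sup>2 / 6)"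
    using inverse_squares_sums by (intro tendsto_of_real) (simp add: sums_def add.commute)
  then show ?thesis by (simp add: squares_c_def[abs_def] add.commute)
qed

lemma barnes_partial_eq:
  "barnes_partial n z = exp (z / 2 * of_real (ln (2 * pi)) - ((1 + of_real euler_mascheroni) * z ^ 2 + z) / 2
      - of_nat n * z + z ^ 2 / 2 * harm_c n) * (\<Prod>k<n. (1 + z / of_nat (Suc k)) ^ Suc k)"
proof -
  have "(\<Sum>k<n. - z + z ^ 2 / (2 * of_nat (Suc k))) = - of_nat n * z + z ^ 2 / 2 * harm_c n"
    by (simp add: sum.distrib sum_subtractf harm_c_def sum_distrib_left)
  then have "(\<Prod>k<n. exp (- z + z ^ 2 / (2 * of_nat (Suc k)))) = exp (- of_nat n * z + z ^ 2 / 2 * harm_c n)"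
    by (simp only: exp_sum[symmetric] finite_lessThan)
  moreover have "complex_of_real (2 * pi) powr (z / 2) = exp (z / 2 * of_real (ln (2 * pi)))"
    by (simp only: powr_def Ln_of_real[of "2 * pi"]) (simp add: Ln_of_real[symmetric])
  moreover have "z / 2 * of_real (ln (2 * pi)) - ((1 + of_real euler_mascheroni) * z ^ 2 + z) / 2
      - of_nat n * z + z ^ 2 / 2 * harm_c n =
      (z / 2 * of_real (ln (2 * pi)) + - ((1 + of_real euler_mascheroni) * z ^ 2 + z) / 2) +
      (- of_nat n * z + z ^ 2 / 2 * harm_c n)"
    by (simp add: minus_divide_left)
  ultimately show ?thesis
    unfolding barnes_partial_def prod.distrib by (simp only: exp_add mult_ac)
qed

text \<open>Both coefficients can be read off from \<open>G s = G (s + 1) / Gamma s\<close>. To the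
  exponent of Barnes' product, the Weierstrass product of the reciprocal gamma function adds
  \<open>euler_mascheroni * s\<close>, and completing its factors to degree 2 costs half the sum of
  the inverse squares, which is \<open>pi^2 / 12\<close>.\<close>

definition barnes_coeff_a :: real where "barnes_coeff_a = - (1 + euler_mascheroni) / 2 - pi\<^sup>2 / 12"

definition barnes_coeff_b :: real where "barnes_coeff_b = ln (2 * pi) / 2 + euler_mascheroni - 1 / 2"

text \<open>The coefficient \<open>b\<close> stays free because it is all that distinguishes
  \<open>G\<close> from the reciprocal of the double gamma function. The power \<open>z ^ 1\<close>
  shows the exponent \<open>r = 1\<close>.\<close>

definition barnes_product :: "real \<Rightarrow> complex \<Rightarrow> complex" where
  "barnes_product b z = z ^ 1 * exp (of_real barnes_coeff_a * z ^ 2 + of_real b * z) *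
     (\<Prod>k. (1 + z / of_real (real (block_index k))) *
        exp (- z / of_real (real (block_index k)) + z ^ 2 / (2 * of_real (real (block_index k)) ^ 2)))"

interpretation barnes_product: genus_two_product "barnes_product b" 1 barnes_coeff_a b "\<lambda>k. real (block_index k)" for b
proof
  show "0 < real (block_index k)" for k using block_index_pos by simp
qed (rule not_summable_block_index_squares summable_block_index_cubes barnes_product_def zero_less_one)+

text \<open>Only at the ends of blocks do all equal factors appear with full multiplicity, so that
  the partial product is comparable with Barnes'.\<close>

lemma barnes_product_E_block_end:
  "barnes_product.E b (block_end n) s = s * exp (of_real barnes_coeff_a * s ^ 2 + of_real b * s
      - s * (of_nat n + harm_c n) + s ^ 2 / 2 * (harm_c n + squares_c n)) *
      (\<Prod>k<n. (1 + s / of_nat (Suc k)) ^ (k + 2))"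
proof -
  define c where "c = (\<lambda>k. - s / of_nat k + s ^ 2 / (2 * of_nat k ^ 2) :: complex)"
  have summand: "of_nat (k + 2) * c (Suc k) =
      - s - s * (1 / of_nat (Suc k)) + s ^ 2 / 2 * (1 / of_nat (Suc k)) + s ^ 2 / 2 * (1 / of_nat (Suc k) ^ 2)" for k
  proof -
    have "(m + 1) * (- s / m + s ^ 2 / (2 * m ^ 2)) = - s - s * (1 / m) + s ^ 2 / 2 * (1 / m) + s ^ 2 / 2 * (1 / m ^ 2)"
      if "m \<noteq> 0" for m using that by (simp add: field_simps power2_eq_square)
    from this[of "of_nat (Suc k)"] show ?thesis by (simp add: c_def del: of_nat_Suc) (simp add: add.commute)
  qed
  have "(\<Prod>k<n. exp (c (Suc k)) ^ (k + 2)) = exp (\<Sum>k<n. of_nat (k + 2) * c (Suc k))"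
    unfolding exp_sum[OF finite_lessThan] exp_of_nat_mult ..
  also have "(\<Sum>k<n. of_nat (k + 2) * c (Suc k)) = - s * (of_nat n + harm_c n) + s ^ 2 / 2 * (harm_c n + squares_c n)"
    unfolding summand sum.distrib sum_subtractf sum_distrib_left[symmetric] harm_c_def[symmetric] squares_c_def[symmetric]
    by (simp add: algebra_simps)
  finally have "(\<Prod>k<n. exp (c (Suc k)) ^ (k + 2)) =
      exp (- s * (of_nat n + harm_c n) + s ^ 2 / 2 * (harm_c n + squares_c n))" .
  moreover have "barnes_product.E b (block_end n) s = s * exp (of_real barnes_coeff_a * s ^ 2 + of_real b * s) *
      (\<Prod>k<n. ((1 + s / of_nat (Suc k)) * exp (c (Suc k))) ^ (k + 2))"
    unfolding barnes_product.E_weierstrass barnes_product.weierstrass_factor_eq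
    using prod_block_index[of "\<lambda>j. (1 + s / of_nat j) * exp (c j)" n] by (simp add: c_def)
  moreover have "of_real barnes_coeff_a * s ^ 2 + of_real b * s
      - s * (of_nat n + harm_c n) + s ^ 2 / 2 * (harm_c n + squares_c n) =
      (of_real barnes_coeff_a * s ^ 2 + of_real b * s) +
      (- s * (of_nat n + harm_c n) + s ^ 2 / 2 * (harm_c n + squares_c n))"
    by simp
  ultimately show ?thesis
    unfolding power_mult_distrib prod.distrib by (simp only: exp_add mult_ac)
qed

text \<open>For \<open>j > 1\<close> the factor \<open>1 + (s - 1) / j\<close> equals
  \<open>(1 + s / (j - 1)) * ((j - 1) / j)\<close>, and for \<open>j = 1\<close> it is
  \<open>s\<close>. The \<open>j\<close>-th powers of \<open>(j - 1) / j\<close> telescope to the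
  quotient on the right.\<close>

lemma shifted_barnes_product:
  fixes s :: complex
  shows "(\<Prod>k<Suc n. (1 + (s - 1) / of_nat (Suc k)) ^ Suc k) =
           s * (\<Prod>k<n. (1 + s / of_nat (Suc k)) ^ (k + 2)) * (fact n / of_nat (Suc n) ^ Suc n)"
proof (induction n)
  case (Suc n)
  define m where "m = complex_of_nat (Suc n)"
  have m: "m \<noteq> 0" "complex_of_nat (Suc (Suc n)) = m + 1" "fact (Suc n) = m * fact n"
    by (simp_all add: m_def del: of_nat_Suc) simp_all
  have m1: "m + 1 \<noteq> 0" unfolding m(2)[symmetric] of_nat_eq_0_iff by simp
  have "1 + (s - 1) / (m + 1) = (m + s) / (m + 1)" "1 + s / m = (m + s) / m"
    using m m1 by (simp_all add: field_simps)
  moreover have "p * (F / m ^ Suc n) * ((m + s) / (m + 1)) ^ Suc (Suc n) =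
      p * ((m + s) / m) ^ (n + 2) * (m * F / (m + 1) ^ Suc (Suc n))" for p F
    using m m1 by (simp add: power_divide)
  ultimately show ?case
    unfolding prod.lessThan_Suc[of _ "Suc n"] Suc.IH m_def[symmetric] m(2,3)
    by (simp only: prod.lessThan_Suc m_def[symmetric] mult.assoc[symmetric])
qed simp

definition stirling_ratio :: "nat \<Rightarrow> real" where
  "stirling_ratio n = fact n * exp (real n) / (real n ^ n * sqrt (real n))"

text \<open>
  The error terms below vanish in the limit exactly for the values chosen for
  \<open>barnes_coeff_a\<close> and \<open>barnes_coeff_b\<close>.
\<close>
definition shift_error :: "nat \<Rightarrow> complex \<Rightarrow> complex" where
  "shift_error n s = s\<^sup>2 * ((of_real (pi\<^sup>2 / 6) - squares_c n) / 2 + 1 / (2 * of_nat (Suc n))) - s / of_nat (Suc n) +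
     (harm_c (Suc n) - of_real (ln (real (Suc n))) - of_real euler_mascheroni) / 2"

lemma shift_error_LIMSEQ: "(\<lambda>n. shift_error n s) \<longlonglongrightarrow> 0"
proof -
  have inv: "(\<lambda>n. 1 / complex_of_nat (Suc n)) \<longlonglongrightarrow> 0"
    using LIMSEQ_Suc[OF lim_1_over_n] .
  have "(\<lambda>n. s\<^sup>2 * ((of_real (pi\<^sup>2 / 6) - squares_c n) / 2 + (1 / of_nat (Suc n)) / 2) - s * (1 / of_nat (Suc n)) +
     (harm_c (Suc n) - of_real (ln (real (Suc n))) - of_real euler_mascheroni) / 2) \<longlonglongrightarrow>
     s\<^sup>2 * ((of_real (pi\<^sup>2 / 6) - of_real (pi\<^sup>2 / 6)) / 2 + 0 / 2) - s * 0 + 0 / 2"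
    by (intro tendsto_add tendsto_diff tendsto_mult tendsto_divide tendsto_const inv squares_c_LIMSEQ
          LIMSEQ_Suc[OF harm_c_LIMSEQ]) auto
  then show ?thesis by (simp add: shift_error_def[abs_def] mult.commute)
qed

text \<open>An exact identity for every \<open>n\<close>: the telescoped quotient of factorial and
  power is rewritten by \<open>stirling_ratio\<close>, and its elementary part is absorbed into the
  exponent. The term \<open>ln (2 * pi) / 2\<close> is what cancels the limit
  \<open>sqrt (2 * pi)\<close> of the ratio.\<close>

lemma barnes_partial_shift:
  "barnes_partial (Suc n) (s - 1) = barnes_product.E barnes_coeff_b (block_end n) s *
     of_real (stirling_ratio (Suc n)) * exp (shift_error n s - of_real (ln (2 * pi)) / 2)"
proof -
  define m where "m = real (Suc n)"
  have m: "m > 0" by (simp add: m_def)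
  have "fact n / m ^ Suc n = stirling_ratio (Suc n) * exp (- m - ln m / 2)"
  proof -
    have "exp (- m - ln m / 2) = 1 / (exp m * sqrt m)"
      using m by (simp add: exp_diff exp_minus ln_sqrt[symmetric] field_simps)
    moreover have "fact (Suc n) = m * fact n" by (simp add: m_def)
    moreover have "m * F * e / (m ^ Suc n * r) * (1 / (e * r)) = F / m ^ Suc n"
      if "e \<noteq> 0" "r \<noteq> 0" "r * r = m" for F e r :: real
      using that m by (simp add: field_simps)
    ultimately show ?thesis
      using m by (simp add: stirling_ratio_def m_def[symmetric] del: power_Suc fact_Suc of_nat_Suc)
  qed
  then have "of_real (fact n / m ^ Suc n) = complex_of_real (stirling_ratio (Suc n)) * exp (of_real (- m - ln m / 2))"
    by (simp only: of_real_mult exp_of_real)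
  then have fact: "fact n / of_nat (Suc n) ^ Suc n =
      complex_of_real (stirling_ratio (Suc n)) * exp (of_real (- m - ln m / 2))"
    by (simp add: m_def)
  define L where "L = complex_of_real (ln (2 * pi))"
  define \<gamma> where "\<gamma> = complex_of_real euler_mascheroni"
  define M where "M = complex_of_nat (Suc n)"
  have M: "M \<noteq> 0" "of_real m = M" "of_nat n = M - 1" by (simp_all add: M_def m_def del: of_nat_Suc) simp
  have "(s - 1) / 2 * L - ((1 + \<gamma>) * (s - 1) ^ 2 + (s - 1)) / 2 - M * (s - 1) + (s - 1) ^ 2 / 2 * harm_c (Suc n)
        + of_real (- m - ln m / 2) =
      (of_real barnes_coeff_a * s ^ 2 + of_real barnes_coeff_b * s - s * (of_nat n + harm_c n) + s ^ 2 / 2 * (harm_c n + squares_c n))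
        + (shift_error n s - L / 2)"
  proof -
    have h: "harm_c n = harm_c (Suc n) - 1 / M" by (simp add: harm_c_Suc M_def)
    have "complex_of_real barnes_coeff_a = - (1 + \<gamma>) / 2 - of_real (pi\<^sup>2 / 6) / 2"
      by (simp add: barnes_coeff_a_def \<gamma>_def)
    moreover have "complex_of_real barnes_coeff_b = L / 2 + \<gamma> - 1 / 2"
      by (simp add: barnes_coeff_b_def \<gamma>_def L_def)
    moreover have "complex_of_real (- m - ln m / 2) = - M - of_real (ln m) / 2"
      by (simp add: M(2)[symmetric])
    moreover have "shift_error n s = s\<^sup>2 * ((of_real (pi\<^sup>2 / 6) - squares_c n) / 2 + 1 / (2 * M)) - s / M +
       (harm_c (Suc n) - of_real (ln m) - \<gamma>) / 2"
      by (simp add: shift_error_def M_def m_def \<gamma>_def)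
    moreover have "(s - 1) / 2 * L - ((1 + \<gamma>) * (s - 1) ^ 2 + (s - 1)) / 2 - M * (s - 1) + (s - 1) ^ 2 / 2 * H
        + (- M - l / 2) =
      ((- (1 + \<gamma>) / 2 - P / 2) * s ^ 2 + (L / 2 + \<gamma> - 1 / 2) * s - s * (M - 1 + (H - 1 / M)) + s ^ 2 / 2 * (H - 1 / M + Z))
        + (s\<^sup>2 * ((P - Z) / 2 + 1 / (2 * M)) - s / M + (H - l - \<gamma>) / 2 - L / 2)" for H l P Z
      using M(1) by (simp add: field_simps power2_eq_square)
    ultimately show ?thesis by (simp only: M(3) h)
  qed
  note eq = this
  have "barnes_partial (Suc n) (s - 1) =
      exp ((s - 1) / 2 * L - ((1 + \<gamma>) * (s - 1) ^ 2 + (s - 1)) / 2 - M * (s - 1) + (s - 1) ^ 2 / 2 * harm_c (Suc n)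
        + of_real (- m - ln m / 2)) * (s * (\<Prod>k<n. (1 + s / of_nat (Suc k)) ^ (k + 2))) * of_real (stirling_ratio (Suc n))"
    unfolding barnes_partial_eq shifted_barnes_product fact exp_add[of _ "of_real (- m - ln m / 2)"]
    unfolding L_def[symmetric] \<gamma>_def[symmetric] M_def[symmetric] by (simp only: mult_ac)
  also have "\<dots> = barnes_product.E barnes_coeff_b (block_end n) s *
     of_real (stirling_ratio (Suc n)) * exp (shift_error n s - L / 2)"
    unfolding eq exp_add[of _ "shift_error n s - L / 2"] barnes_product_E_block_end by (simp only: mult_ac)
  finally show ?thesis unfolding L_def .
qed

text \<open>The functional equation at the level of partial products: one copy of each factor
  \<open>1 + s / k\<close> goes to the series for the reciprocal gamma function, the remaining
  \<open>k\<close> copies form Barnes' product at \<open>s\<close>.\<close>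

lemma barnes_product_E_rGamma:
  "barnes_product.E barnes_coeff_b (block_end n) s = barnes_partial n s * rGamma_series s n *
     exp (s\<^sup>2 * ((squares_c n - of_real (pi\<^sup>2 / 6)) / 2) -
          s * (harm_c n - of_real (ln (real n)) - of_real euler_mascheroni))"
proof -
  define L where "L = complex_of_real (ln (2 * pi))"
  define \<gamma> where "\<gamma> = complex_of_real euler_mascheroni"
  define l where "l = complex_of_real (ln (real n))"
  define P where "P = (\<Prod>k<n. 1 + s / of_nat (Suc k))"
  have "pochhammer s (j + 1) = s * (\<Prod>k<j. 1 + s / of_nat (Suc k)) * fact j" for j
  proof (induction j)
    case (Suc j)
    have eq: "(1 + s / m) * m = s + m" if "m \<noteq> 0" for m
      using that by (simp add: field_simps)
    have "pochhammer s (Suc j + 1) = pochhammer s (j + 1) * (s + of_nat (Suc j))"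
      using pochhammer_Suc[of s "j + 1"] by simp
    also have "s + of_nat (Suc j) = (1 + s / of_nat (Suc j)) * of_nat (Suc j)"
      by (rule eq[symmetric]) (simp del: of_nat_Suc)
    finally show ?case unfolding Suc.IH by (simp only: prod.lessThan_Suc fact_Suc mult_ac)
  qed simp
  then have "pochhammer s (n + 1) = s * P * fact n" by (simp only: P_def)
  then have rG: "rGamma_series s n = s * P * exp (- s * l)"
    by (simp add: rGamma_series_def l_def exp_minus field_simps)
  have "(\<Prod>k<n. (1 + s / of_nat (Suc k)) ^ (k + 2)) = (\<Prod>k<n. (1 + s / of_nat (Suc k)) ^ Suc k) * P"
    unfolding P_def prod.distrib[symmetric] by (intro prod.cong) (simp_all add: mult_ac)
  note prod = this
  have "of_real barnes_coeff_a * s ^ 2 + of_real barnes_coeff_b * s - s * (of_nat n + harm_c n)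
          + s ^ 2 / 2 * (harm_c n + squares_c n) =
        (s / 2 * L - ((1 + \<gamma>) * s ^ 2 + s) / 2 - of_nat n * s + s ^ 2 / 2 * harm_c n) + (- s * l) +
        (s\<^sup>2 * ((squares_c n - of_real (pi\<^sup>2 / 6)) / 2) - s * (harm_c n - l - \<gamma>))"
  proof -
    have "complex_of_real barnes_coeff_a = - (1 + \<gamma>) / 2 - of_real (pi\<^sup>2 / 6) / 2"
      by (simp add: barnes_coeff_a_def \<gamma>_def)
    moreover have "complex_of_real barnes_coeff_b = L / 2 + \<gamma> - 1 / 2"
      by (simp add: barnes_coeff_b_def \<gamma>_def L_def)
    moreover have "(- (1 + \<gamma>) / 2 - Q / 2) * s ^ 2 + (L / 2 + \<gamma> - 1 / 2) * s - s * (N + H) + s ^ 2 / 2 * (H + Z) =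
        (s / 2 * L - ((1 + \<gamma>) * s ^ 2 + s) / 2 - N * s + s ^ 2 / 2 * H) + (- s * l) +
        (s\<^sup>2 * ((Z - Q) / 2) - s * (H - l - \<gamma>))" for N H Z Q
      by (simp add: field_simps)
    ultimately show ?thesis by (simp only:)
  qed
  note eq = this
  show ?thesis
    unfolding barnes_product_E_block_end barnes_partial_eq rG prod
      L_def[symmetric] \<gamma>_def[symmetric] l_def[symmetric] eq exp_add by (simp only: mult_ac)
qed

lemma barnes_product_E_LIMSEQ: "(\<lambda>n. barnes_product.E b (block_end n) s) \<longlonglongrightarrow> barnes_product b s"
  using LIMSEQ_subseq_LIMSEQ[OF barnes_product.E_LIMSEQ strict_mono_block_end] by (simp add: o_def)

lemma barnes_partial_0: "barnes_partial n 0 = 1"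
  by (simp add: barnes_partial_def)

text \<open>
  Convergence of Stirling's ratio comes for free from the convergence of the products at
  \<open>s = 1\<close>; only the value of the limit needs Wallis' formula.
\<close>
lemma stirling_ratio_LIMSEQ: "stirling_ratio \<longlonglongrightarrow> sqrt (2 * pi)"
proof -
  define L where "L = ln (2 * pi)"
  define c where "c = on_reals (barnes_product barnes_coeff_b) 1"
  have c: "c > 0" "barnes_product barnes_coeff_b 1 = of_real c"
    using barnes_product.g_pos[of 1 barnes_coeff_b] barnes_product.f_of_real[of barnes_coeff_b 1] by (simp_all add: c_def)
  have X: "(\<lambda>n. barnes_product.E barnes_coeff_b (block_end n) 1 * exp (shift_error n 1 - of_real L / 2))
          \<longlonglongrightarrow> of_real c * exp (0 - of_real L / 2)"
    unfolding c(2)[symmetric]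
    by (intro tendsto_intros barnes_product_E_LIMSEQ shift_error_LIMSEQ) auto
  have "(\<lambda>n. 1 / (barnes_product.E barnes_coeff_b (block_end n) 1 * exp (shift_error n 1 - of_real L / 2)))
          \<longlonglongrightarrow> 1 / (of_real c * exp (0 - of_real L / 2))"
    by (rule tendsto_divide[OF tendsto_const X]) (use c in auto)
  moreover have "1 / (barnes_product.E barnes_coeff_b (block_end n) 1 * exp (shift_error n 1 - of_real L / 2))
      = of_real (stirling_ratio (Suc n))" for n
  proof -
    have "1 = barnes_product.E barnes_coeff_b (block_end n) 1 * of_real (stirling_ratio (Suc n)) *
            exp (shift_error n 1 - of_real L / 2)"
      using barnes_partial_shift[of n 1] by (simp add: barnes_partial_0 L_def)
    moreover have "1 = x * d * e \<Longrightarrow> 1 / (x * e) = d" for x d e :: complex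
      by (cases "x * e = 0") (auto simp: field_simps)
    ultimately show ?thesis by blast
  qed
  moreover have "1 / (of_real c * exp (0 - of_real L / 2)) = complex_of_real (1 / (c * exp (- L / 2)))"
    by (simp flip: exp_of_real)
  ultimately have "(\<lambda>n. complex_of_real (stirling_ratio (Suc n))) \<longlonglongrightarrow> of_real (1 / (c * exp (- L / 2)))"
    by (simp only:)
  then have "(\<lambda>n. stirling_ratio (Suc n)) \<longlonglongrightarrow> 1 / (c * exp (- L / 2))"
    by (simp only: tendsto_of_real_iff)
  then have lim: "stirling_ratio \<longlonglongrightarrow> 1 / (c * exp (- L / 2))" by (rule LIMSEQ_imp_Suc)
  moreover have "1 / (c * exp (- L / 2)) = sqrt (2 * pi)"
    by (rule stirling_constant) (use lim c in \<open>simp_all add: stirling_ratio_def[abs_def]\<close>)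
  ultimately show ?thesis by simp
qed

theorem barnes_G_eq_barnes_product: "barnes_G = barnes_product barnes_coeff_b"
proof
  fix s
  have "(\<lambda>n. barnes_product.E barnes_coeff_b (block_end n) s * of_real (stirling_ratio (Suc n)) *
          exp (shift_error n s - of_real (ln (2 * pi)) / 2)) \<longlonglongrightarrow>
        barnes_product barnes_coeff_b s * of_real (sqrt (2 * pi)) * exp (0 - of_real (ln (2 * pi)) / 2)"
    by (intro tendsto_intros barnes_product_E_LIMSEQ shift_error_LIMSEQ LIMSEQ_Suc[OF stirling_ratio_LIMSEQ]) auto
  then have "(\<lambda>n. barnes_partial (Suc n) (s - 1)) \<longlonglongrightarrow>
        barnes_product barnes_coeff_b s * of_real (sqrt (2 * pi)) * exp (0 - of_real (ln (2 * pi)) / 2)"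
    by (simp only: barnes_partial_shift)
  moreover have "(\<lambda>n. barnes_partial (Suc n) (s - 1)) \<longlonglongrightarrow> barnes_G s"
    using LIMSEQ_Suc[OF barnes_partial_LIMSEQ] .
  ultimately have "barnes_G s = barnes_product barnes_coeff_b s * of_real (sqrt (2 * pi)) * exp (0 - of_real (ln (2 * pi)) / 2)"
    using LIMSEQ_unique by blast
  also have "exp (0 - complex_of_real (ln (2 * pi)) / 2) = of_real (1 / sqrt (2 * pi))"
  proof -
    have "exp (- ln (2 * pi) / 2) = 1 / sqrt (2 * pi)"
      using ln_sqrt[of "2 * pi"] by (simp add: exp_minus inverse_eq_divide flip: ln_sqrt)
    then show ?thesis by (metis (no_types) diff_0 exp_of_real minus_divide_left of_real_divide of_real_minus of_real_numeral)
  qed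
  finally show "barnes_G s = barnes_product barnes_coeff_b s"
    by (simp flip: of_real_mult)
qed

text \<open>This is \<open>G (s + 1) = Gamma s * G s\<close>, written with the entire reciprocal so
  that it holds at the poles of the gamma function too.\<close>

lemma barnes_G_rGamma: "barnes_G s = barnes_G (s + 1) * rGamma s"
proof -
  have "(\<lambda>n. barnes_partial n ((s + 1) - 1) * rGamma_series s n *
     exp (s\<^sup>2 * ((squares_c n - of_real (pi\<^sup>2 / 6)) / 2) -
          s * (harm_c n - of_real (ln (real n)) - of_real euler_mascheroni))) \<longlonglongrightarrow>
     barnes_G (s + 1) * rGamma s *
     exp (s\<^sup>2 * ((of_real (pi\<^sup>2 / 6) - of_real (pi\<^sup>2 / 6)) / 2) - s * 0)"
    by (intro tendsto_intros barnes_partial_LIMSEQ squares_c_LIMSEQ harm_c_LIMSEQ) auto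
  then have "(\<lambda>n. barnes_product.E barnes_coeff_b (block_end n) s) \<longlonglongrightarrow> barnes_G (s + 1) * rGamma s"
    by (simp only: barnes_product_E_rGamma add_diff_cancel_right' diff_self div_0 mult_zero_right
        diff_zero exp_zero mult_1_right)
  then show ?thesis
    using barnes_product_E_LIMSEQ[of barnes_coeff_b s] LIMSEQ_unique by (simp add: barnes_G_eq_barnes_product) blast
qed

section \<open>Values of \<open>G\<close> at positive integers\<close>

lemma barnes_G_Suc:
  assumes "n > 0"
  shows "barnes_G (of_nat n + 1) = fact (n - 1) * barnes_G (of_nat n)"
proof -
  have "Gamma (of_nat n :: complex) = fact (n - 1)"
    using Gamma_fact[of "n - 1"] assms by (simp add: of_nat_diff)
  then have "rGamma (of_nat n :: complex) = 1 / fact (n - 1)"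
    by (simp add: Gamma_def inverse_eq_divide) (metis divide_inverse inverse_inverse_eq mult_1)
  then show ?thesis using barnes_G_rGamma[of "of_nat n"] by (simp add: field_simps)
qed

lemma barnes_G_1: "barnes_G 1 = 1"
  by (simp add: barnes_G_def)

lemma barnes_G_values: "barnes_G 2 = 1" "barnes_G 4 = 2" "barnes_G 6 = 288"
proof -
  show 2: "barnes_G 2 = 1" using barnes_G_Suc[of 1] by (simp add: barnes_G_1)
  have 3: "barnes_G 3 = 1" using barnes_G_Suc[of 2] by (simp add: 2)
  show 4: "barnes_G 4 = 2" using barnes_G_Suc[of 3] by (simp add: 3)
  have 5: "barnes_G 5 = 12" using barnes_G_Suc[of 4] by (simp add: 4 fact_numeral)
  show "barnes_G 6 = 288" using barnes_G_Suc[of 5] by (simp add: 5 fact_numeral)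
qed

section \<open>The reciprocal of the double gamma function\<close>

lemma inverse_Gamma2_eq:
  "1 / Gamma2 z = barnes_G z * exp (- (z / 2 * of_real (ln (2 * pi))))"
proof -
  have "complex_of_real (2 * pi) powr (z / 2) = exp (z / 2 * of_real (ln (2 * pi)))"
    by (simp only: powr_def Ln_of_real[of "2 * pi"]) (simp add: Ln_of_real[symmetric])
  then show ?thesis by (simp add: Gamma2_def exp_minus field_simps)
qed

lemma inverse_Gamma2_eq_barnes_product: "(\<lambda>z. 1 / Gamma2 z) = barnes_product (barnes_coeff_b - ln (2 * pi) / 2)"
proof
  fix z
  have "1 / Gamma2 z = barnes_product barnes_coeff_b z * exp (- (z / 2 * of_real (ln (2 * pi))))"
    by (simp add: inverse_Gamma2_eq barnes_G_eq_barnes_product)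
  also have "\<dots> = barnes_product (barnes_coeff_b - ln (2 * pi) / 2) z"
  proof -
    have "exp (of_real barnes_coeff_a * z\<^sup>2 + of_real (barnes_coeff_b - ln (2 * pi) / 2) * z) =
        exp (of_real barnes_coeff_a * z\<^sup>2 + of_real barnes_coeff_b * z) * exp (- (z / 2 * of_real (ln (2 * pi))))"
      by (simp add: exp_add[symmetric] algebra_simps)
    then show ?thesis unfolding barnes_product_def by (simp only: mult_ac)
  qed
  finally show "1 / Gamma2 z = barnes_product (barnes_coeff_b - ln (2 * pi) / 2) z" .
qed

lemma barnes_product_in_class_G:
  assumes "\<exists>c d. 0 \<le> c \<and> c < d \<and> strict_antimono_on {c<..<d} (on_reals (barnes_product b))"
  shows "barnes_product b \<in> class_G"
  unfolding class_G_def mem_Collect_eq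
proof (intro conjI)
  show "\<exists>(r::nat) (a::real) (b'::real) (l::nat \<Rightarrow> real).
      (\<forall>k. 0 < l k) \<and> incseq l \<and> \<not> summable (\<lambda>k. 1 / l k ^ 2) \<and> summable (\<lambda>k. 1 / l k ^ 3) \<and>
      (\<forall>z. barnes_product b z = z ^ r * exp (of_real a * z ^ 2 + of_real b' * z) *
           (\<Prod>k. (1 + z / of_real (l k)) *
                 exp (- z / of_real (l k) + z ^ 2 / (2 * of_real (l k) ^ 2))))"
  proof (intro exI conjI allI)
    show "0 < real (block_index k)" for k using block_index_pos by simp
    show "incseq (\<lambda>k. real (block_index k))"
      using incseq_block_index by (auto simp: incseq_def)
  qed (rule not_summable_block_index_squares summable_block_index_cubes barnes_product_def)+
qed (fact barnes_product.f_holomorphic assms)+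

theorem corollary5p8:
  defines "g \<equiv> on_reals barnes_G"
    and "h \<equiv> on_reals (\<lambda>z. 1 / Gamma2 z)"
  shows
    "(barnes_G \<in> class_G \<and>
      (\<exists>!x. is_pos_local_min g x) \<and>
      strict_mono_on {beta_G<..} g \<and>
      bij_betw g {beta_G<..} {g beta_G<..} \<and>
      bij_betw (the_inv_into {beta_G<..} g) {g beta_G<..} {beta_G<..} \<and>
      extends_to_univalent_Pick_function (the_inv_into {beta_G<..} g) {g beta_G<..})
     \<and>
     ((\<lambda>z. 1 / Gamma2 z) \<in> class_G \<and>
      (\<exists>!x. is_pos_local_min h x) \<and>
      strict_mono_on {beta_2<..} h \<and>
      bij_betw h {beta_2<..} {h beta_2<..} \<and>
      bij_betw (the_inv_into {beta_2<..} h) {h beta_2<..} {beta_2<..} \<and>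
      extends_to_univalent_Pick_function (the_inv_into {beta_2<..} h) {h beta_2<..})"
proof -
  \<comment> \<open>The third point is 4 because \<open>G 3 = 1\<close> does not yet exceed
    \<open>G 2\<close>.\<close>
  have "g 1 = 1" "g 2 = 1" "g 4 = 2"
    by (simp_all add: g_def on_reals_def barnes_G_1 barnes_G_values)
  then have G: "(1::real) < 2" "(2::real) < 4" "g 2 \<le> g 1" "g 2 < g 4" by simp_all
  note G = barnes_product.inverse_extends[OF zero_less_one G(1,2), of barnes_coeff_b,
      folded barnes_G_eq_barnes_product g_def, OF G(3,4)]
  have h_eq: "h x = g x * exp (- (x / 2 * ln (2 * pi)))" for x
  proof -
    have "exp (- (complex_of_real x / 2 * of_real (ln (2 * pi)))) = of_real (exp (- (x / 2 * ln (2 * pi))))"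
      by (simp flip: exp_of_real)
    then show ?thesis
      by (simp only: h_def g_def on_reals_def inverse_Gamma2_eq Re_complex_of_real) simp
  qed
  \<comment> \<open>This is \<open>1 / sqrt (2 * pi)\<close>, so that
    \<open>h n = g n * e ^ n\<close> at the integers.\<close>
  define e where "e = exp (- ln (2 * pi) / 2)"
  have e: "0 < e" "e * e = 1 / (2 * pi)"
    by (simp_all add: e_def exp_minus inverse_eq_divide flip: exp_add)
  have "e ^ n = exp (- (real n / 2 * ln (2 * pi)))" for n
    by (simp add: e_def flip: exp_of_nat_mult)
  from this[of 1] this[of 2] this[of 6] have h: "h 1 = e" "h 2 = e\<^sup>2" "h 6 = 288 * e ^ 6"
    by (simp_all add: h_eq g_def on_reals_def barnes_G_1 barnes_G_values)
  have "e < 1" unfolding e_def using pi_gt3 by (simp add: ln_gt_zero)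
  then have "e * e \<le> e" using e(1) by (simp add: mult_left_le)
  \<comment> \<open>This amounts to \<open>(2 * pi)^2 < 288\<close>. The integer 6 is the first that
    works: \<open>12 * e ^ 5\<close> is still below \<open>e ^ 2\<close>, since
    \<open>(2 * pi) powr (3 / 2)\<close> exceeds 12.\<close>
  moreover have "e\<^sup>2 < 288 * e ^ 6"
  proof -
    have "(2 * pi) * (2 * pi) \<le> 8 * 8" using pi_less_4 pi_gt_zero by (intro mult_mono) auto
    then have "1 < 288 * (1 / (2 * pi))\<^sup>2" by (simp add: field_simps power2_eq_square)
    then have "1 < 288 * (e * e)\<^sup>2" by (simp only: e(2))
    then have "e\<^sup>2 * 1 < e\<^sup>2 * (288 * (e * e)\<^sup>2)" using e(1) by (intro mult_strict_left_mono) auto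
    then show ?thesis by (simp add: power2_eq_square eval_nat_numeral mult_ac)
  qed
  ultimately have H: "(1::real) < 2" "(2::real) < 6" "h 2 \<le> h 1" "h 2 < h 6"
    by (simp_all add: h power2_eq_square)
  note H = barnes_product.inverse_extends[OF zero_less_one H(1,2), of "barnes_coeff_b - ln (2 * pi) / 2",
      folded inverse_Gamma2_eq_barnes_product h_def, OF H(3,4)]
  show ?thesis
    unfolding beta_G_def beta_2_def g_def[symmetric] h_def[symmetric]
    using G H barnes_product_in_class_G[of barnes_coeff_b] barnes_product_in_class_G[of "barnes_coeff_b - ln (2 * pi) / 2"]
    unfolding barnes_G_eq_barnes_product[symmetric] inverse_Gamma2_eq_barnes_product[symmetric] g_def[symmetric] h_def[symmetric]
    by blast
qed

end
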